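(* For $h\in\mathcal Z_+'$ let $\theta,a,b,s,h^\natural$ be the distributions associated with $h$ by the formulas $$\theta(x)=e^xh(e^x),\quad a=\Phi\theta,\quad b(\xi)=(2\pi)^{-1/2}a(\xi)\Gamma(1-i\xi)^{-1},\quad s=\sqrt{2\pi}\,\Phi^*b,\quad h^\natural(\lambda)=\lambda^{-1}s(-\ln\lambda).$$ Then the mappings $$h\mapsto\theta\mapsto a\mapsto b\mapsto s\mapsto h^\natural$$ yield one-to-one correspondences (bijections) $$\mathcal Z_+'\to\mathcal Z'\to C_0^\infty(\mathbb R)'\to C_0^\infty(\mathbb R)'\to\mathcal Z'\to\mathcal Z_+'.$$ All of them, as well as their inverse mappings, are continuous.
   Context: Notation: $\mathbb R_+=(0,\infty)$; $\Gamma$ is the gamma function; $(\Phi u)(\xi)=(2\pi)^{-1/2}\int_{-\infty}^\infty u(x)e^{-ix\xi}dx$ is the Fourier transform. For a topological vector space $\mathcal L$, $\mathcal L'$ is the space of continuous antilinear functionals with the (weak) dual topology; brackets $\langle\cdot,\cdot\rangle$ are linear in the first and antilinear in the second argument. $\mathcal Z$ is the set of Schwartz functions $\varphi$ on $\mathbb R$ that extend to entire functions with $|\varphi(z)|\le C_n(1+|z|)^{-n}e^{r|\operatorname{Im}z|}$ for all $n$ and some $r=r(\varphi)>0$; thus $\Phi:C_0^\infty(\mathbb R)\to\mathcal Z$ and $\Phi^*:\mathcal Z\to C_0^\infty(\mathbb R)$ are bijections, and $\mathcal Z$ carries the corresponding topology. $\mathcal Z_+$ is the set of functions $F$ on $\mathbb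 R_+$ such that $\Omega(x)=F(e^x)$ belongs to $\mathcal Z$ (with the transferred topology), and $\mathcal Z_+'$ is its dual. Precise meaning of the formulas: $\langle\theta,\Omega\rangle=\langle h,F\rangle$ for $\Omega(x)=F(e^x)$, $F\in\mathcal Z_+$; $\langle a,g\rangle=\langle\theta,\Phi^*g\rangle$ for $g\in C_0^\infty(\mathbb R)$; $\langle b,G\rangle=(2\pi)^{-1/2}\langle a,\Gamma(1+i\,\cdot)^{-1}G\rangle$ for $G\in C_0^\infty(\mathbb R)$; $\langle s,\varphi\rangle=\sqrt{2\pi}\langle b,\Phi\varphi\rangle$ for $\varphi\in\mathcal Z$; $\langle h^\natural,F\rangle=\langle s,\varphi\rangle$ with $\varphi(x)=F(e^{-x})$, $F\in\mathcal Z_+$. *)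

theory Defs
  imports "HOL-Analysis.Analysis"
begin

subsection \<open>Smooth functions and test functions\<close>

definition nderiv :: "nat \<Rightarrow> (real \<Rightarrow> complex) \<Rightarrow> real \<Rightarrow> complex" where
  "nderiv k f = ((\<lambda>g x. vector_derivative g (at x)) ^^ k) f"

definition smooth :: "(real \<Rightarrow> complex) \<Rightarrow> bool" where
  "smooth f \<longleftrightarrow> (\<forall>k x. nderiv k f differentiable (at x))"

definition schwartz :: "(real \<Rightarrow> complex) \<Rightarrow> bool" where
  "schwartz f \<longleftrightarrow> smooth f \<and> (\<forall>m k. \<exists>C. \<forall>x. \<bar>x\<bar> ^ m * norm (nderiv k f x) \<le> C)"

definition test_space :: "(real \<Rightarrow> complex) set" where
  "test_space = {f. smooth f \<and> compact (closure {x. f x \<noteq> 0})}"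

definition test_space_on :: "real set \<Rightarrow> (real \<Rightarrow> complex) set" where
  "test_space_on K = {f \<in> test_space. closure {x. f x \<noteq> 0} \<subseteq> K}"

text \<open>The Frechet topology on the test functions supported in \<open>K\<close>: uniform convergence
  of all derivatives.\<close>

definition test_topology_on :: "real set \<Rightarrow> (real \<Rightarrow> complex) topology" where
  "test_topology_on K = topology (\<lambda>U. U \<subseteq> test_space_on K \<and>
     (\<forall>f\<in>U. \<exists>N. \<exists>\<epsilon>>0. \<forall>g\<in>test_space_on K.
        (\<forall>k\<le>N. \<forall>x. norm (nderiv k g x - nderiv k f x) < \<epsilon>) \<longrightarrow> g \<in> U))"

text \<open>The locally convex inductive limit topology on the test functions: a base of
  neighbourhoods of zero is given by the absolutely convex sets (that is, convex and balanced
  over the complex scalars) whose intersection with the test functions supported in \<open>K\<close> is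
  open there, for every compact \<open>K\<close>. Membership of zero only excludes the empty set.\<close>

definition test_nhd_base :: "(real \<Rightarrow> complex) set set" where
  "test_nhd_base = {W. W \<subseteq> test_space \<and> (\<lambda>_. 0) \<in> W \<and>
     (\<forall>f\<in>W. \<forall>g\<in>W. \<forall>a b :: complex. norm a + norm b \<le> 1 \<longrightarrow> (\<lambda>x. a * f x + b * g x) \<in> W) \<and>
     (\<forall>K. compact K \<longrightarrow> openin (test_topology_on K) (W \<inter> test_space_on K))}"

definition test_topology :: "(real \<Rightarrow> complex) topology" where
  "test_topology = topology (\<lambda>U. U \<subseteq> test_space \<and>
     (\<forall>f\<in>U. \<exists>W\<in>test_nhd_base. \<forall>w\<in>W. (\<lambda>x. f x + w x) \<in> U))"


subsection \<open>The Fourier transform and the spaces of analytic test functions\<close>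

definition fourier :: "(real \<Rightarrow> complex) \<Rightarrow> real \<Rightarrow> complex" where
  "fourier u \<xi> = complex_of_real (1 / sqrt (2 * pi)) *
     (LINT x|lborel. u x * exp (- \<i> * complex_of_real (x * \<xi>)))"

definition fourier_adj :: "(real \<Rightarrow> complex) \<Rightarrow> real \<Rightarrow> complex" where
  "fourier_adj g x = complex_of_real (1 / sqrt (2 * pi)) *
     (LINT \<xi>|lborel. g \<xi> * exp (\<i> * complex_of_real (x * \<xi>)))"

definition Z_space :: "(real \<Rightarrow> complex) set" where
  "Z_space = {\<phi>. schwartz \<phi> \<and>
     (\<exists>f. f holomorphic_on UNIV \<and> (\<forall>x. f (complex_of_real x) = \<phi> x) \<and>
        (\<exists>r>0. \<forall>n::nat. \<exists>C. \<forall>z. norm (f z) \<le> C / (1 + norm z) ^ n * exp (r * \<bar>Im z\<bar>)))}"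

text \<open>The topology transferred from the test functions. By the Paley--Wiener theorem
  \<open>fourier_adj\<close> maps \<open>Z_space\<close> bijectively onto \<open>test_space\<close>, so the carrier of this topology
  is all of \<open>Z_space\<close>.\<close>

definition Z_topology :: "(real \<Rightarrow> complex) topology" where
  "Z_topology = pullback_topology Z_space fourier_adj test_topology"

text \<open>A function on the half-line \<open>{0<..}\<close> is encoded as a function on \<open>\<real>\<close> that vanishes
  outside of \<open>{0<..}\<close>.\<close>

definition Zplus_space :: "(real \<Rightarrow> complex) set" where
  "Zplus_space = {F. (\<forall>t\<le>0. F t = 0) \<and> (\<lambda>x. F (exp x)) \<in> Z_space}"

definition Zplus_topology :: "(real \<Rightarrow> complex) topology" where
  "Zplus_topology = pullback_topology Zplus_space (\<lambda>F x. F (exp x)) Z_topology"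


subsection \<open>Antilinear dual spaces\<close>

text \<open>A topological vector space of complex functions (with pointwise operations) is given by
  its topology. A functional \<open>u\<close> on it is encoded as a function with the value \<open>undefined\<close>
  outside of the carrier, and the pairing of \<open>u\<close> with \<open>f\<close> is \<open>u f\<close>.\<close>

definition antidual :: "('a \<Rightarrow> complex) topology \<Rightarrow> (('a \<Rightarrow> complex) \<Rightarrow> complex) set" where
  "antidual T = {u \<in> extensional (topspace T).
     (\<forall>f\<in>topspace T. \<forall>g\<in>topspace T. u (\<lambda>x. f x + g x) = u f + u g) \<and>
     (\<forall>f\<in>topspace T. \<forall>c. u (\<lambda>x. c * f x) = cnj c * u f) \<and>
     continuous_map T euclidean u}"

text \<open>The weak dual topology is that of pointwise convergence.\<close>

definition antidual_topology ::
    "('a \<Rightarrow> complex) topology \<Rightarrow> (('a \<Rightarrow> complex) \<Rightarrow> complex) topology" where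
  "antidual_topology T =
     subtopology (product_topology (\<lambda>_. euclidean) (topspace T)) (antidual T)"


subsection \<open>The mappings\<close>

text \<open>The formulas \<open>\<theta>(x) = e\<^sup>x h(e\<^sup>x)\<close>, \<open>a = \<Phi>\<theta>\<close>, etc. are understood in the sense of distributions,
  by duality. The argument of \<open>h\<close> in \<open>theta_of_h\<close> is the function \<open>F\<close> on \<open>{0<..}\<close> with
  \<open>\<Omega>(x) = F(e\<^sup>x)\<close>. In \<open>b_of_a\<close>, multiplication by \<open>1 / \<Gamma>(1 - i\<xi>)\<close> becomes multiplication of
  the test function by the complex conjugate.\<close>

type_synonym functional = "(real \<Rightarrow> complex) \<Rightarrow> complex"

definition theta_of_h :: "functional \<Rightarrow> functional" where
  "theta_of_h h = (\<lambda>\<Omega>\<in>Z_space. h (\<lambda>t. if t > 0 then \<Omega> (ln t) else 0))"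

definition a_of_theta :: "functional \<Rightarrow> functional" where
  "a_of_theta \<theta> = (\<lambda>g\<in>test_space. \<theta> (fourier_adj g))"

definition b_of_a :: "functional \<Rightarrow> functional" where
  "b_of_a a = (\<lambda>G\<in>test_space. complex_of_real (1 / sqrt (2 * pi)) *
     a (\<lambda>\<xi>. inverse (Gamma (1 + \<i> * complex_of_real \<xi>)) * G \<xi>))"

definition s_of_b :: "functional \<Rightarrow> functional" where
  "s_of_b b = (\<lambda>\<phi>\<in>Z_space. complex_of_real (sqrt (2 * pi)) * b (fourier \<phi>))"

definition hnat_of_s :: "functional \<Rightarrow> functional" where
  "hnat_of_s s = (\<lambda>F\<in>Zplus_space. s (\<lambda>x. F (exp (- x))))"


subsection \<open>Basic facts about the topologies\<close>

lemma nderiv_0 [simp]: "nderiv 0 f = f"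
  by (simp add: nderiv_def)

lemma nderiv_Suc: "nderiv (Suc k) f = (\<lambda>x. vector_derivative (nderiv k f) (at x))"
  by (simp add: nderiv_def)

lemma nderiv_lincomb:
  assumes "smooth f" "smooth g"
  shows "nderiv k (\<lambda>x. a * f x + b * g x) = (\<lambda>x. a * nderiv k f x + b * nderiv k g x)"
proof (induction k)
  case (Suc k)
  have *: "(nderiv k u has_vector_derivative nderiv (Suc k) u x) (at x)" if "smooth u" for u x
    using that by (auto simp: smooth_def nderiv_Suc vector_derivative_works[symmetric])
  have "vector_derivative (\<lambda>x. a * nderiv k f x + b * nderiv k g x) (at x)
      = a * nderiv (Suc k) f x + b * nderiv (Suc k) g x" for x
    by (intro vector_derivative_at has_vector_derivative_add has_vector_derivative_mult_right *
        assms)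
  then show ?case
    by (subst nderiv_Suc) (simp add: Suc)
qed simp

lemma test_space_lincomb:
  assumes "f \<in> test_space" "g \<in> test_space"
  shows "(\<lambda>x. a * f x + b * g x) \<in> test_space"
proof -
  have sm: "smooth f" "smooth g"
    using assms by (auto simp: test_space_def)
  have "smooth (\<lambda>x. a * f x + b * g x)"
    unfolding smooth_def nderiv_lincomb[OF sm]
    using sm by (intro allI differentiable_add differentiable_mult) (simp_all add: smooth_def)
  moreover have "compact (closure {x. a * f x + b * g x \<noteq> 0})"
  proof (rule compact_closure[THEN iffD2], rule bounded_subset)
    show "bounded (closure {x. f x \<noteq> 0} \<union> closure {x. g x \<noteq> 0})"
      using assms by (simp add: test_space_def compact_imp_bounded)
    show "{x. a * f x + b * g x \<noteq> 0} \<subseteq> closure {x. f x \<noteq> 0} \<union> closure {x. g x \<noteq> 0}"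
    proof
      fix x assume "x \<in> {x. a * f x + b * g x \<noteq> 0}"
      then have "x \<in> {x. f x \<noteq> 0} \<or> x \<in> {x. g x \<noteq> 0}" by auto
      then show "x \<in> closure {x. f x \<noteq> 0} \<union> closure {x. g x \<noteq> 0}"
        by (meson UnI1 UnI2 closure_subset subsetD)
    qed
  qed
  ultimately show ?thesis
    by (simp add: test_space_def)
qed

lemma zero_in_test_space: "(\<lambda>_. 0) \<in> test_space"
proof -
  have "nderiv k (\<lambda>_. 0) = (\<lambda>_. 0)" for k
    by (induction k) (simp_all add: nderiv_Suc)
  then show ?thesis
    by (simp add: test_space_def smooth_def)
qed

lemma istopology_pointwise:
  assumes "\<And>f U V. P f U \<Longrightarrow> U \<subseteq> V \<Longrightarrow> P f V"
    and "\<And>f U V. P f U \<Longrightarrow> P f V \<Longrightarrow> P f (U \<inter> V)"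
  shows "istopology (\<lambda>U. U \<subseteq> A \<and> (\<forall>f\<in>U. P f U))"
  unfolding istopology_def
proof (intro conjI allI impI)
  fix \<U> assume U: "\<forall>U\<in>\<U>. U \<subseteq> A \<and> (\<forall>f\<in>U. P f U)"
  then show "\<Union>\<U> \<subseteq> A" by blast
  show "\<forall>f\<in>\<Union>\<U>. P f (\<Union>\<U>)"
  proof
    fix f assume "f \<in> \<Union>\<U>"
    then obtain V where "V \<in> \<U>" "f \<in> V" by blast
    then show "P f (\<Union>\<U>)" using U assms(1)[of f V] by (simp add: Union_upper)
  qed
qed (use assms(2) in auto)

lemma openin_test_topology_on:
  "openin (test_topology_on K) U \<longleftrightarrow> U \<subseteq> test_space_on K \<and>
     (\<forall>f\<in>U. \<exists>N. \<exists>\<epsilon>>0. \<forall>g\<in>test_space_on K.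
        (\<forall>k\<le>N. \<forall>x. norm (nderiv k g x - nderiv k f x) < \<epsilon>) \<longrightarrow> g \<in> U)"
proof -
  define P where "P f U \<longleftrightarrow> (\<exists>N. \<exists>\<epsilon>>0. \<forall>g\<in>test_space_on K.
        (\<forall>k\<le>N. \<forall>x. norm (nderiv k g x - nderiv k f x) < \<epsilon>) \<longrightarrow> g \<in> U)" for f U
  have mono: "P f V" if "P f U" "U \<subseteq> V" for f U V
    using that unfolding P_def by blast
  have int: "P f (U \<inter> V)" if U: "P f U" and V: "P f V" for f U V
  proof -
    obtain N \<epsilon> where 1: "\<epsilon> > 0" "\<And>g. g \<in> test_space_on K \<Longrightarrow>
        (\<forall>k\<le>N. \<forall>x. norm (nderiv k g x - nderiv k f x) < \<epsilon>) \<Longrightarrow> g \<in> U"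
      using U unfolding P_def by metis
    obtain M \<delta> where 2: "\<delta> > 0" "\<And>g. g \<in> test_space_on K \<Longrightarrow>
        (\<forall>k\<le>M. \<forall>x. norm (nderiv k g x - nderiv k f x) < \<delta>) \<Longrightarrow> g \<in> V"
      using V unfolding P_def by metis
    show ?thesis
      unfolding P_def
      by (rule exI[of _ "max M N"], rule exI[of _ "min \<epsilon> \<delta>"]) (use 1 2 in auto)
  qed
  have "istopology (\<lambda>U. U \<subseteq> test_space_on K \<and> (\<forall>f\<in>U. P f U))"
    by (rule istopology_pointwise) (use int mono in simp_all)
  then show ?thesis
    unfolding test_topology_on_def P_def by (subst topology_inverse') auto
qed

lemma test_nhd_base_Int:
  assumes "V \<in> test_nhd_base" "W \<in> test_nhd_base"
  shows "V \<inter> W \<in> test_nhd_base"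
proof -
  have "openin (test_topology_on K) (V \<inter> W \<inter> test_space_on K)" if "compact K" for K
  proof -
    have "V \<inter> W \<inter> test_space_on K = (V \<inter> test_space_on K) \<inter> (W \<inter> test_space_on K)"
      by blast
    then show ?thesis
      using assms that by (auto simp: test_nhd_base_def)
  qed
  then show ?thesis
    using assms by (auto simp: test_nhd_base_def)
qed

lemma test_space_in_test_nhd_base: "test_space \<in> test_nhd_base"
proof -
  have "openin (test_topology_on K) (test_space_on K)" for K
    unfolding openin_test_topology_on using zero_less_one by blast
  moreover have "test_space \<inter> test_space_on K = test_space_on K" for K
    by (auto simp: test_space_on_def)
  ultimately show ?thesis
    by (simp add: test_nhd_base_def zero_in_test_space test_space_lincomb)
qed

lemma openin_test_topology:
  "openin test_topology U \<longleftrightarrow> U \<subseteq> test_space \<and>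
     (\<forall>f\<in>U. \<exists>W\<in>test_nhd_base. \<forall>w\<in>W. (\<lambda>x. f x + w x) \<in> U)"
proof -
  define P where "P f U \<longleftrightarrow> (\<exists>W\<in>test_nhd_base. \<forall>w\<in>W. (\<lambda>x. f x + w x) \<in> U)"
    for f :: "real \<Rightarrow> complex" and U
  have mono: "P f V" if "P f U" "U \<subseteq> V" for f U V
    using that unfolding P_def by blast
  have int: "P f (U \<inter> V)" if "P f U" "P f V" for f U V
    using that unfolding P_def by (meson IntI Int_iff test_nhd_base_Int)
  have "istopology (\<lambda>U. U \<subseteq> test_space \<and> (\<forall>f\<in>U. P f U))"
    by (rule istopology_pointwise) (use int mono in simp_all)
  then show ?thesis
    unfolding test_topology_def P_def by (subst topology_inverse') auto
qed

lemma topspace_test_topology: "topspace test_topology = test_space"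
proof
  show "topspace test_topology \<subseteq> test_space"
    by (meson openin_test_topology openin_topspace)
  have "(\<lambda>x. f x + w x) \<in> test_space" if "f \<in> test_space" "w \<in> test_space" for f w
    using test_space_lincomb[OF that, of 1 1] by simp
  then have "openin test_topology test_space"
    unfolding openin_test_topology using test_space_in_test_nhd_base by blast
  then show "test_space \<subseteq> topspace test_topology"
    by (rule openin_subset)
qed

lemma topspace_antidual_topology: "topspace (antidual_topology T) = antidual T"
  by (auto simp: antidual_topology_def antidual_def PiE_UNIV_domain PiE_def)

end

theory Submission
  imports Defs "HOL-Complex_Analysis.Complex_Analysis" "HOL-Probability.Probability"
begin

text \<open>Each of the five mappings is, up to a nonzero scalar, the transpose of a linear homeomorphism
  between the spaces of test functions, and such a transpose is a homeomorphism of the weak duals.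
  For \<open>\<theta>\<close> and \<open>h\<^sup>\<natural>\<close> the homeomorphism is a substitution (and a reflection), for \<open>a\<close> and \<open>s\<close> it is
  the Fourier transform, which is bijective by the Paley--Wiener theorem and Fourier inversion, and
  for \<open>b\<close> it is the multiplication by the smooth function \<open>1 / \<Gamma>(1 + i\<xi>)\<close>, whose reciprocal is smooth
  as well. The topology of \<open>Z_space\<close> is pulled back along the adjoint transform, whereas \<open>a\<close> needs this
  transform as a map into \<open>Z_space\<close>; it is continuous there because its square is the reflection.\<close>

subsection \<open>Operators on test functions\<close>

text \<open>On the line in question the reciprocal of the Gamma function grows exponentially, since
  |Gamma(1 + i xi)|^2 = pi xi / sinh(pi xi). Multiplication by it therefore does not preserve
  Schwartz functions, whereas functions of compact support absorb every smooth factor. This is why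
  the test functions on the Fourier side have compact support and those on the other side are
  entire. Since \<open>Z_topology\<close> is transported, the Paley--Wiener theorem enters only as
  an equality of sets: no estimate has to relate growth constants of entire functions to norms of
  test functions. Norm estimates remain only for the two elementary operators, reflection and
  multiplication.\<close>

lemma smooth_has_vector_derivative:
  assumes "smooth f"
  shows "(nderiv k f has_vector_derivative nderiv (Suc k) f x) (at x)"
  using assms by (simp add: smooth_def nderiv_Suc vector_derivative_works[symmetric])

text \<open>Exhibiting the whole tower \<open>G\<close> of derivatives at once lets a single
  derivative computation yield both the formula for \<open>nderiv\<close> and, through
  \<open>smoothI\<close>, smoothness.\<close>

lemma nderiv_eqI:
  assumes "G 0 = f" "\<And>k x. (G k has_vector_derivative G (Suc k) x) (at x)"
  shows "nderiv k f = G k"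
proof (induction k)
  case (Suc k)
  then show ?case
    using assms(2) by (auto simp: nderiv_Suc vector_derivative_at)
qed (use assms in simp)

lemma smoothI:
  assumes "G 0 = f" "\<And>k x. (G k has_vector_derivative G (Suc k) x) (at x)"
  shows "smooth f"
  unfolding smooth_def nderiv_eqI[of G, OF assms]
  using assms(2) differentiableI_vector by blast

lemma nderiv_nderiv: "nderiv k (nderiv j f) = nderiv (k + j) f"
  by (simp add: nderiv_def funpow_add)

lemma smooth_nderiv: "smooth f \<Longrightarrow> smooth (nderiv j f)"
  by (simp add: smooth_def nderiv_nderiv)

lemma smooth_isCont: "smooth f \<Longrightarrow> isCont (nderiv k f) x"
  by (meson has_vector_derivative_continuous smooth_has_vector_derivative)

lemma smooth_continuous_on: "smooth f \<Longrightarrow> continuous_on S (nderiv k f)"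
  by (simp add: continuous_at_imp_continuous_on smooth_isCont)

text \<open>The unexpanded Leibniz rule: this form avoids binomial coefficients, and its derivative is
  immediate by induction.\<close>

primrec leibniz :: "nat \<Rightarrow> (real \<Rightarrow> complex) \<Rightarrow> (real \<Rightarrow> complex) \<Rightarrow> real \<Rightarrow> complex" where
  "leibniz 0 f g = (\<lambda>x. f x * g x)"
| "leibniz (Suc k) f g = (\<lambda>x. leibniz k (nderiv 1 f) g x + leibniz k f (nderiv 1 g) x)"

lemma leibniz_has_vector_derivative:
  assumes "smooth f" "smooth g"
  shows "(leibniz k f g has_vector_derivative leibniz (Suc k) f g x) (at x)"
  using assms
proof (induction k arbitrary: f g)
  case 0
  have "((\<lambda>x. f x * g x) has_vector_derivative f x * nderiv 1 g x + nderiv 1 f x * g x) (at x)"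
    using has_vector_derivative_mult[OF smooth_has_vector_derivative[OF 0(1), of 0 x]
        smooth_has_vector_derivative[OF 0(2), of 0 x]] by simp
  then show ?case
    by (simp add: add.commute)
next
  case (Suc k)
  show ?case
    unfolding leibniz.simps(2)[of k f g] leibniz.simps(2)[of "Suc k" f g]
    by (rule has_vector_derivative_add; rule Suc.IH)
       (use Suc.prems smooth_nderiv in auto)
qed

lemma nderiv_mult:
  assumes "smooth f" "smooth g"
  shows "nderiv k (\<lambda>x. f x * g x) = leibniz k f g"
  by (rule nderiv_eqI) (use leibniz_has_vector_derivative[OF assms] in auto)

lemma smooth_mult:
  assumes "smooth f" "smooth g"
  shows "smooth (\<lambda>x. f x * g x)"
  by (rule smoothI[of "\<lambda>k. leibniz k f g"]) (use leibniz_has_vector_derivative[OF assms] in auto)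

text \<open>The factor \<open>2 ^ k\<close> counts the products in \<open>leibniz k f g\<close>,
  whose number doubles with each step of the recursion.\<close>

lemma norm_leibniz_le:
  assumes "\<And>j. j \<le> k \<Longrightarrow> norm (nderiv j f x) \<le> A" "\<And>j. j \<le> k \<Longrightarrow> norm (nderiv j g x) \<le> B"
  shows "norm (leibniz k f g x) \<le> 2 ^ k * A * B"
  using assms
proof (induction k arbitrary: f g)
  case 0
  have "0 \<le> A"
    using 0(1)[of 0] norm_ge_zero[of "f x"] by (simp del: norm_ge_zero)
  then show ?case
    using 0(1)[of 0] 0(2)[of 0] by (simp add: norm_mult mult_mono)
next
  case (Suc k)
  have "norm (leibniz k (nderiv 1 f) g x) \<le> 2 ^ k * A * B"
    "norm (leibniz k f (nderiv 1 g) x) \<le> 2 ^ k * A * B"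
    by (rule Suc.IH; use Suc.prems in \<open>simp add: nderiv_nderiv\<close>)+
  then show ?case
    using norm_triangle_ineq[of "leibniz k (nderiv 1 f) g x" "leibniz k f (nderiv 1 g) x"] by simp
qed

lemma nderiv_reflect:
  assumes "smooth f"
  shows "nderiv k (\<lambda>x. f (- x)) = (\<lambda>x. (-1) ^ k * nderiv k f (- x))"
    and "smooth (\<lambda>x. f (- x))"
proof -
  define G where "G k x = (-1) ^ k * nderiv k f (- x)" for k x
  have G: "(G k has_vector_derivative G (Suc k) x) (at x)" for k x
  proof -
    have "(nderiv k f \<circ> uminus has_vector_derivative (-1) *\<^sub>R nderiv (Suc k) f (- x)) (at x)"
      by (rule vector_diff_chain_at) (auto intro!: derivative_eq_intros smooth_has_vector_derivative assms)
    from has_vector_derivative_mult_right[OF this, of "(-1)^k"] show ?thesis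
      by (simp add: G_def[abs_def] o_def)
  qed
  have G0: "G 0 = (\<lambda>x. f (- x))"
    by (simp add: G_def[abs_def])
  show "nderiv k (\<lambda>x. f (- x)) = (\<lambda>x. (-1) ^ k * nderiv k f (- x))"
    using nderiv_eqI[of G, OF G0 G, of k] by (simp add: G_def[abs_def])
  show "smooth (\<lambda>x. f (- x))"
    by (rule smoothI[of G, OF G0 G])
qed

section \<open>Supports and functions supported in a fixed compact set\<close>

text \<open>A derivative at a point depends on a neighbourhood, so the induction carries vanishing
  on the whole open complement of \<open>S\<close>.\<close>

lemma nderiv_eq_0:
  assumes "closed S" "{x. f x \<noteq> 0} \<subseteq> S" "x \<notin> S"
  shows "nderiv k f x = 0"
  using assms(3)
proof (induction k arbitrary: x)
  case (Suc k)
  have "(nderiv k f has_vector_derivative 0) (at x)"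
    by (rule has_vector_derivative_transform_within_open[OF has_vector_derivative_const[of 0], where S = "- S"])
       (use Suc assms in \<open>auto simp: open_Compl\<close>)
  then show ?case
    by (simp add: nderiv_Suc vector_derivative_at)
qed (use assms in auto)

lemma test_space_onI:
  assumes "smooth f" "compact K" "{x. f x \<noteq> 0} \<subseteq> K"
  shows "f \<in> test_space_on K"
proof -
  have "closure {x. f x \<noteq> 0} \<subseteq> K"
    using assms by (simp add: closure_minimal compact_imp_closed)
  then have "compact (closure {x. f x \<noteq> 0})"
    using assms(2) by (meson bounded_subset closed_closure compact_eq_bounded_closed)
  then show ?thesis
    using \<open>closure _ \<subseteq> K\<close> assms by (simp add: test_space_on_def test_space_def)
qed

lemma test_space_smooth: "f \<in> test_space \<Longrightarrow> smooth f"
  by (simp add: test_space_def)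

lemma test_space_on_support: "f \<in> test_space_on K \<Longrightarrow> {x. f x \<noteq> 0} \<subseteq> K"
  by (auto simp: test_space_on_def intro: subsetD[OF closure_subset])

lemma test_space_on_subset: "test_space_on K \<subseteq> test_space"
  by (auto simp: test_space_on_def)

lemma test_space_on_lincomb:
  assumes "compact K" "f \<in> test_space_on K" "g \<in> test_space_on K"
  shows "(\<lambda>x. a * f x + b * g x) \<in> test_space_on K"
proof (rule test_space_onI)
  show "smooth (\<lambda>x. a * f x + b * g x)"
    by (rule test_space_smooth, rule test_space_lincomb) (use assms test_space_on_subset in auto)
  show "{x. a * f x + b * g x \<noteq> 0} \<subseteq> K"
    using test_space_on_support[OF assms(2)] test_space_on_support[OF assms(3)]
    by (auto simp: subset_iff) (metis add_0 mult_zero_right)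
qed (use assms in auto)

lemma test_spaceE:
  assumes "f \<in> test_space"
  obtains R where "R > 0" "f \<in> test_space_on {-R..R}"
proof -
  have "bounded {x. f x \<noteq> 0}"
    using assms bounded_subset[OF compact_imp_bounded closure_subset] by (auto simp: test_space_def)
  then obtain R where "R > 0" "\<And>x. f x \<noteq> 0 \<Longrightarrow> \<bar>x\<bar> \<le> R"
    by (auto simp: bounded_pos)
  moreover from this have "f \<in> test_space_on {-R..R}"
    by (intro test_space_onI) (use assms test_space_smooth in \<open>force simp: abs_le_iff\<close>)+
  ultimately show ?thesis
    using that by blast
qed

section \<open>Continuity of linear operators in the inductive limit topology\<close>

text \<open>Neighbourhoods of zero in the inductive limit are tested on each compact set separately.
  For a linear operator it is thus enough to send functions supported in \<open>K\<close> to
  functions supported in one compact \<open>L\<close>, with an estimate of the derivatives up to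
  order \<open>N\<close> by those up to the same order.\<close>

lemma continuous_map_test_topology:
  assumes lin: "\<And>f g a b. f \<in> test_space \<Longrightarrow> g \<in> test_space \<Longrightarrow>
      A (\<lambda>x. a * f x + b * g x) = (\<lambda>x. a * A f x + b * A g x)"
    and test: "\<And>f. f \<in> test_space \<Longrightarrow> A f \<in> test_space"
    and bound: "\<And>K. compact K \<Longrightarrow> \<exists>L. compact L \<and> (\<forall>f\<in>test_space_on K. A f \<in> test_space_on L) \<and>
      (\<forall>N. \<exists>C>0. \<forall>f\<in>test_space_on K. \<forall>B. (\<forall>k\<le>N. \<forall>x. norm (nderiv k f x) \<le> B) \<longrightarrow>
         (\<forall>k\<le>N. \<forall>x. norm (nderiv k (A f) x) \<le> C * B))"
  shows "continuous_map test_topology test_topology A"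
proof -
  \<comment> \<open>The preimage of a base neighbourhood is again one: linearity makes it absolutely
    convex, and the estimate makes its trace on each compact set open.\<close>
  define V where "V W = {f \<in> test_space. A f \<in> W}" for W
  have V: "V W \<in> test_nhd_base" if W: "W \<in> test_nhd_base" for W
  proof -
    have "A (\<lambda>x. 0 * 0 + 0 * 0) = (\<lambda>x. 0 * A (\<lambda>_. 0) x + 0 * A (\<lambda>_. 0) x)"
      by (rule lin) (auto simp: zero_in_test_space)
    then have zero: "(\<lambda>_. 0) \<in> V W"
      using W by (simp add: V_def zero_in_test_space test_nhd_base_def)
    have conv: "(\<lambda>x. a * f x + b * g x) \<in> V W"
      if "f \<in> V W" "g \<in> V W" "norm a + norm b \<le> 1" for f g a b
      using that W lin test_space_lincomb by (auto simp: V_def test_nhd_base_def)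
    have "openin (test_topology_on K) (V W \<inter> test_space_on K)" if K: "compact K" for K
      unfolding openin_test_topology_on
    proof (intro conjI ballI)
      fix f assume f: "f \<in> V W \<inter> test_space_on K"
      obtain L where L: "compact L" "\<And>f. f \<in> test_space_on K \<Longrightarrow> A f \<in> test_space_on L"
        and C: "\<And>N. \<exists>C>0. \<forall>f\<in>test_space_on K. \<forall>B. (\<forall>k\<le>N. \<forall>x. norm (nderiv k f x) \<le> B) \<longrightarrow>
         (\<forall>k\<le>N. \<forall>x. norm (nderiv k (A f) x) \<le> C * B)"
        using bound[OF K] by blast
      have "openin (test_topology_on L) (W \<inter> test_space_on L)"
        using W L by (simp add: test_nhd_base_def)
      moreover have "A f \<in> W \<inter> test_space_on L"
        using f L by (auto simp: V_def)
      ultimately obtain N \<epsilon> where \<epsilon>: "\<epsilon> > 0" "\<And>g. g \<in> test_space_on L \<Longrightarrow>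
          (\<And>k x. k \<le> N \<Longrightarrow> norm (nderiv k g x - nderiv k (A f) x) < \<epsilon>) \<Longrightarrow> g \<in> W"
        unfolding openin_test_topology_on by (metis IntE)
      obtain c where c: "c > 0" "\<And>f B k x. f \<in> test_space_on K \<Longrightarrow> (\<And>k x. k \<le> N \<Longrightarrow> norm (nderiv k f x) \<le> B) \<Longrightarrow>
         k \<le> N \<Longrightarrow> norm (nderiv k (A f) x) \<le> c * B"
        using C[of N] by blast
      \<comment> \<open>The estimate turns the radius \<open>\<epsilon> / (2 * c)\<close> into a
        bound by \<open>\<epsilon> / 2\<close> that is not strict; the factor 2 restores the strict
        inequality.\<close>
      have "g \<in> V W \<inter> test_space_on K"
        if g: "g \<in> test_space_on K"
          and le: "\<forall>k\<le>N. \<forall>x. norm (nderiv k g x - nderiv k f x) < \<epsilon> / (2 * c)" for g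
      proof -
        have fg: "f \<in> test_space" "g \<in> test_space"
          using f g test_space_on_subset by auto
        have d: "(\<lambda>x. 1 * g x + (-1) * f x) \<in> test_space_on K"
          using f g K by (intro test_space_on_lincomb) auto
        have "A g \<in> W"
        proof (rule \<epsilon>(2))
          fix k x assume k: "k \<le> N"
          have "nderiv k g x - nderiv k f x = nderiv k (\<lambda>x. 1 * g x + (-1) * f x) x" for k x
            using fg test_space_smooth by (subst nderiv_lincomb) auto
          then have "norm (nderiv k (\<lambda>x. 1 * g x + (-1) * f x) x) \<le> \<epsilon> / (2 * c)" if "k \<le> N" for k x
            using le that by (metis less_imp_le)
          from c(2)[OF d this k]
          have "norm (nderiv k (A (\<lambda>x. 1 * g x + (-1) * f x)) x) \<le> \<epsilon> / 2"
            using c(1) by (simp add: field_simps)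
          also have "nderiv k (A (\<lambda>x. 1 * g x + (-1) * f x)) x = nderiv k (A g) x - nderiv k (A f) x"
            using fg test_space_smooth test lin[OF fg(2,1), of 1 "-1"]
              nderiv_lincomb[of "A g" "A f" k 1 "-1"] by simp
          finally show "norm (nderiv k (A g) x - nderiv k (A f) x) < \<epsilon>"
            using \<epsilon>(1) by linarith
        qed (use L g in auto)
        then show ?thesis
          using fg g by (simp add: V_def)
      qed
      then show "\<exists>N. \<exists>\<epsilon>>0. \<forall>g\<in>test_space_on K.
        (\<forall>k\<le>N. \<forall>x. norm (nderiv k g x - nderiv k f x) < \<epsilon>) \<longrightarrow> g \<in> V W \<inter> test_space_on K"
        using c(1) \<epsilon>(1) by (intro exI[of _ N] exI[of _ "\<epsilon> / (2 * c)"]) auto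
    qed auto
    then show ?thesis
      using zero conv by (auto simp: test_nhd_base_def V_def)
  qed
  have "openin test_topology {f \<in> test_space. A f \<in> U}" if U: "openin test_topology U" for U
    unfolding openin_test_topology
  proof (intro conjI ballI)
    fix f assume f: "f \<in> {f \<in> test_space. A f \<in> U}"
    then obtain W where W: "W \<in> test_nhd_base" "\<And>w. w \<in> W \<Longrightarrow> (\<lambda>x. A f x + w x) \<in> U"
      using U unfolding openin_test_topology by blast
    have "(\<lambda>x. f x + w x) \<in> {f \<in> test_space. A f \<in> U}" if "w \<in> V W" for w
      using that f W(2)[of "A w"] lin[of f w 1 1] test_space_lincomb[of f w 1 1] by (simp add: V_def)
    then show "\<exists>W\<in>test_nhd_base. \<forall>w\<in>W. (\<lambda>x. f x + w x) \<in> {f \<in> test_space. A f \<in> U}"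
      using V[OF W(1)] by blast
  qed auto
  then show ?thesis
    using test by (auto simp: continuous_map topspace_test_topology)
qed

lemma reflect_test_space_on:
  assumes "compact K" "f \<in> test_space_on K"
  shows "(\<lambda>x. f (- x)) \<in> test_space_on (uminus ` K)"
proof (rule test_space_onI)
  show "smooth (\<lambda>x. f (- x))"
    using assms test_space_smooth test_space_on_subset by (intro nderiv_reflect) auto
  show "{x. f (- x) \<noteq> 0} \<subseteq> uminus ` K"
    using test_space_on_support[OF assms(2)] by (force simp: image_iff)
qed (simp add: assms compact_negations)

lemma reflect_test_space: "f \<in> test_space \<Longrightarrow> (\<lambda>x. f (- x)) \<in> test_space"
  using reflect_test_space_on[OF compact_Icc] test_space_on_subset by (blast elim: test_spaceE)

lemma continuous_map_reflect: "continuous_map test_topology test_topology (\<lambda>f x. f (- x))"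
proof (rule continuous_map_test_topology)
  fix K :: "real set" assume K: "compact K"
  have "norm (nderiv k (\<lambda>x. f (- x)) x) \<le> 1 * B"
    if "f \<in> test_space_on K" "\<forall>k\<le>N. \<forall>x. norm (nderiv k f x) \<le> B" "k \<le> N" for f N B k x
    using that subsetD[OF test_space_on_subset that(1)]
    by (subst nderiv_reflect) (auto simp: norm_mult norm_power intro: test_space_smooth)
  moreover have "compact (uminus ` K)"
    by (simp add: K compact_negations)
  ultimately show "\<exists>L. compact L \<and> (\<forall>f\<in>test_space_on K. (\<lambda>x. f (- x)) \<in> test_space_on L) \<and>
      (\<forall>N. \<exists>C>0. \<forall>f\<in>test_space_on K. \<forall>B. (\<forall>k\<le>N. \<forall>x. norm (nderiv k f x) \<le> B) \<longrightarrow>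
         (\<forall>k\<le>N. \<forall>x. norm (nderiv k (\<lambda>x. f (- x)) x) \<le> C * B))"
    using reflect_test_space_on[OF K] zero_less_one by metis
qed (auto simp: reflect_test_space)

lemma mult_test_space_on:
  assumes "smooth m" "compact K" "f \<in> test_space_on K"
  shows "(\<lambda>x. m x * f x) \<in> test_space_on K"
  using assms test_space_on_support[OF assms(3)] subsetD[OF test_space_on_subset assms(3)]
  by (intro test_space_onI smooth_mult) (auto intro: test_space_smooth)

lemma mult_test_space: "smooth m \<Longrightarrow> f \<in> test_space \<Longrightarrow> (\<lambda>x. m x * f x) \<in> test_space"
  using mult_test_space_on[OF _ compact_Icc] test_space_on_subset by (blast elim: test_spaceE)

text \<open>The support does not grow, so \<open>L\<close> can be \<open>K\<close> itself, and only
  the suprema over \<open>K\<close> of the derivatives of \<open>m\<close> enter the constant. This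
  is what admits factors of arbitrary growth at infinity.\<close>

lemma continuous_map_mult:
  assumes m: "smooth m"
  shows "continuous_map test_topology test_topology (\<lambda>f x. m x * f x)"
proof (rule continuous_map_test_topology)
  fix K :: "real set" assume K: "compact K"
  have "\<exists>C>0. \<forall>f\<in>test_space_on K. \<forall>B. (\<forall>k\<le>N. \<forall>x. norm (nderiv k f x) \<le> B) \<longrightarrow>
         (\<forall>k\<le>N. \<forall>x. norm (nderiv k (\<lambda>x. m x * f x) x) \<le> C * B)" for N
  proof -
    have "\<exists>A. \<forall>x\<in>K. norm (nderiv j m x) \<le> A" for j
    proof -
      have "bounded (nderiv j m ` K)"
        by (intro compact_imp_bounded compact_continuous_image smooth_continuous_on m K)
      then show ?thesis
        by (auto simp: bounded_iff)
    qed
    then obtain A where A: "\<And>j x. x \<in> K \<Longrightarrow> norm (nderiv j m x) \<le> A j"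
      by metis
    \<comment> \<open>One bound for all orders up to \<open>N\<close>. The absolute values are there
      because \<open>A j\<close> may be negative when \<open>K\<close> is empty; the summand 1 makes
      \<open>M\<close> positive.\<close>
    define M where "M = 1 + (\<Sum>j\<le>N. \<bar>A j\<bar>)"
    have M: "norm (nderiv j m x) \<le> M" if "x \<in> K" "j \<le> N" for j x
      using A[OF that(1), of j] member_le_sum[of j "{..N}" "\<lambda>j. \<bar>A j\<bar>"] that(2) by (simp add: M_def)
    have M0: "M > 0"
      unfolding M_def by (smt (verit) sum_nonneg)
    have "norm (nderiv k (\<lambda>x. m x * f x) x) \<le> (2 ^ N * M) * B"
      if f: "f \<in> test_space_on K" and B: "\<forall>k\<le>N. \<forall>x. norm (nderiv k f x) \<le> B" and k: "k \<le> N" for f B k x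
    proof (cases "x \<in> K")
      case True
      have B0: "B \<ge> 0"
        using B norm_ge_zero[of "nderiv 0 f x"] by (meson le0 order_trans)
      have "norm (nderiv k (\<lambda>x. m x * f x) x) \<le> 2 ^ k * M * B"
        using m f test_space_on_subset
        by (subst nderiv_mult) (use True B M k in \<open>auto intro!: norm_leibniz_le test_space_smooth\<close>)
      also have "\<dots> \<le> 2 ^ N * M * B"
        using k M0 B0 by (intro mult_right_mono power_increasing) auto
      finally show ?thesis .
    next
      case False
      have "nderiv k (\<lambda>x. m x * f x) x = 0"
        by (rule nderiv_eq_0[OF compact_imp_closed[OF K] _ False])
           (use test_space_on_support[OF f] in auto)
      moreover have "B \<ge> 0"
        using B norm_ge_zero[of "nderiv 0 f x"] by (meson le0 order_trans)
      ultimately show ?thesis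
        using M0 by simp
    qed
    then show ?thesis
      using M0 by (intro exI[of _ "2 ^ N * M"]) auto
  qed
  then show "\<exists>L. compact L \<and> (\<forall>f\<in>test_space_on K. (\<lambda>x. m x * f x) \<in> test_space_on L) \<and>
      (\<forall>N. \<exists>C>0. \<forall>f\<in>test_space_on K. \<forall>B. (\<forall>k\<le>N. \<forall>x. norm (nderiv k f x) \<le> B) \<longrightarrow>
         (\<forall>k\<le>N. \<forall>x. norm (nderiv k (\<lambda>x. m x * f x) x) \<le> C * B))"
    using mult_test_space_on[OF m K] K by blast
qed (auto simp: mult_test_space m distrib_left mult.left_commute)

subsection \<open>The Paley--Wiener theorem and Fourier inversion\<close>

text \<open>Complex derivatives restrict to real ones along the line, which makes Cauchy's estimates
  available for \<open>nderiv\<close>. The open set \<open>S\<close> is general because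
  \<open>Gamma (1 + \<i> * z)\<close> has poles off the real line.\<close>

lemma restrict_holomorphic:
  assumes "f holomorphic_on S" "open S" "\<And>x. complex_of_real x \<in> S"
  shows smooth_restrict: "smooth (\<lambda>x. f (complex_of_real x))"
    and nderiv_restrict: "nderiv k (\<lambda>x. f (complex_of_real x)) = (\<lambda>x. (deriv ^^ k) f (complex_of_real x))"
proof -
  define G where "G k x = (deriv ^^ k) f (complex_of_real x)" for k x
  have G: "(G k has_vector_derivative G (Suc k) x) (at x)" for k x
    unfolding G_def
    using has_field_derivative_higher_deriv[OF assms(1,2,3), of k x]
    by (rule has_vector_derivative_real_field)
  have G0: "G 0 = (\<lambda>x. f (complex_of_real x))"
    by (simp add: G_def[abs_def])
  show "smooth (\<lambda>x. f (complex_of_real x))"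
    by (rule smoothI[of G, OF G0 G])
  show "nderiv k (\<lambda>x. f (complex_of_real x)) = (\<lambda>x. (deriv ^^ k) f (complex_of_real x))"
    using nderiv_eqI[of G, OF G0 G, of k] by (simp add: G_def[abs_def])
qed

lemma Z_spaceI:
  assumes f: "f holomorphic_on UNIV" and "r > 0"
    and bound: "\<And>n::nat. \<exists>C. \<forall>z. norm (f z) \<le> C / (1 + norm z) ^ n * exp (r * \<bar>Im z\<bar>)"
  shows "(\<lambda>x. f (complex_of_real x)) \<in> Z_space"
proof -
  have "\<exists>C. \<forall>x. \<bar>x\<bar> ^ m * norm (nderiv k (\<lambda>x. f (complex_of_real x)) x) \<le> C" for m k
  proof -
    obtain C where C: "\<And>z. norm (f z) \<le> C / (1 + norm z) ^ m * exp (r * \<bar>Im z\<bar>)"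
      using bound by blast
    have "0 \<le> C / (1 + norm (0::complex)) ^ m * exp (r * \<bar>Im 0\<bar>)"
      by (rule order_trans[OF norm_ge_zero C])
    then have C0: "C \<ge> 0"
      by simp
    \<comment> \<open>Cauchy's inequality on the circle of radius 1 turns decay of \<open>f\<close> in the strip into decay of
      every derivative, so the Schwartz condition in \<open>Z_space\<close> follows from the growth bounds.\<close>
    have "\<bar>x\<bar> ^ m * norm (nderiv k (\<lambda>x. f (complex_of_real x)) x) \<le> fact k * (C * exp r)" for x
    proof (cases "\<bar>x\<bar> ^ m = 0")
      case False
      have "\<bar>x\<bar> ^ m \<ge> 0"
        by simp
      with False have pos: "\<bar>x\<bar> ^ m > 0"
        by linarith
      have "norm ((deriv ^^ k) f (complex_of_real x)) \<le> fact k * (C * exp r / \<bar>x\<bar> ^ m) / 1 ^ k"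
      proof (rule Cauchy_inequality)
        fix z :: complex
        assume z: "norm (complex_of_real x - z) = 1"
        \<comment> \<open>The 1 in the weight \<open>1 + norm z\<close> compensates exactly for the
          radius of the circle.\<close>
        have "\<bar>x\<bar> \<le> 1 + norm z"
          using norm_triangle_ineq[of "complex_of_real x - z" z] z by simp
        then have "\<bar>x\<bar> ^ m \<le> (1 + norm z) ^ m"
          by (intro power_mono) auto
        moreover have "\<bar>Im z\<bar> \<le> 1"
          using abs_Im_le_cmod[of "complex_of_real x - z"] z by simp
        ultimately have "C / (1 + norm z) ^ m * exp (r * \<bar>Im z\<bar>) \<le> C / \<bar>x\<bar> ^ m * exp r"
          using C0 \<open>r > 0\<close> mult_pos_pos[OF zero_less_power[of "1 + norm z" m] pos]
          by (intro mult_mono divide_left_mono) (auto simp: add_pos_nonneg)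
        then show "norm (f z) \<le> C * exp r / \<bar>x\<bar> ^ m"
          using C[of z] by simp
      qed (use f holomorphic_on_subset holomorphic_on_imp_continuous_on in auto)
      then show ?thesis
        using pos by (subst nderiv_restrict[OF f]) (auto simp: field_simps)
    next
      case True
      show ?thesis
        unfolding True using C0 by simp
    qed
    then show ?thesis
      by blast
  qed
  then have "schwartz (\<lambda>x. f (complex_of_real x))"
    using smooth_restrict[OF f] by (simp add: schwartz_def)
  then show ?thesis
    unfolding Z_space_def using assms by blast
qed

text \<open>This reduces the weight to the powers 0 and n, the two that are controlled by the
  Fourier integral itself and by its n-fold integration by parts.\<close>

lemma one_plus_power_le: "(1 + a) ^ n \<le> 2 ^ n * (1 + a ^ n)" if "a \<ge> 0" for a :: real
proof (cases "a \<le> 1")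
  case True
  then have "(1 + a) ^ n \<le> 2 ^ n * 1"
    using that by (simp add: power_mono)
  also have "\<dots> \<le> 2 ^ n * (1 + a ^ n)"
    using that by (intro mult_left_mono) auto
  finally show ?thesis .
next
  case False
  then have "(1 + a) ^ n \<le> (2 * a) ^ n"
    by (intro power_mono) auto
  also have "\<dots> \<le> 2 ^ n * (1 + a ^ n)"
    by (simp add: power_mult_distrib)
  finally show ?thesis .
qed

text \<open>Compact support lets the integral be evaluated at complex arguments, with exponential
  type given by the size of the interval. Integration by parts trades powers of z for derivatives of
  \<open>g\<close>, which gives decay of every order.\<close>

lemma fourier_adj_test:
  assumes g: "g \<in> test_space"
  shows "fourier_adj g \<in> Z_space"
proof -
  obtain R where "R > 0" and gR: "g \<in> test_space_on {-R..R}"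
    using g by (rule test_spaceE)
  \<comment> \<open>The margin puts the end points outside the support interval, where
    \<open>g\<close> and all its derivatives vanish; integration by parts then leaves no boundary
    terms.\<close>
  define S where "S = R + 1"
  have S: "S > 0" and SR: "S \<notin> {-R..R}" "- S \<notin> {-R..R}"
    using \<open>R > 0\<close> by (auto simp: S_def)
  have sm: "smooth g"
    using g by (rule test_space_smooth)
  define E where "E z t = exp (\<i> * (complex_of_real t * z))" for z t
  define F where "F n z = integral {-S..S} (\<lambda>t. nderiv n g t * E z t)" for n z
  have contE: "continuous_on A (E z)" for z A
    unfolding E_def by (intro continuous_intros)
  have intE: "(\<lambda>t. nderiv n g t * E z t) integrable_on {-S..S}" for n z
    by (intro integrable_continuous_interval continuous_intros smooth_continuous_on sm contE)
  have normE: "norm (E z t) \<le> exp (S * \<bar>Im z\<bar>)" if "t \<in> {-S..S}" for z t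
  proof -
    have "- (t * Im z) \<le> \<bar>t\<bar> * \<bar>Im z\<bar>"
      by (metis abs_ge_minus_self abs_mult)
    also have "\<dots> \<le> S * \<bar>Im z\<bar>"
      using that by (intro mult_right_mono) auto
    finally show ?thesis
      by (simp add: E_def)
  qed
  have hol: "F 0 holomorphic_on UNIV"
  proof -
    have "(\<lambda>z. integral (cbox (-S) S) (\<lambda>t. g t * E z t)) holomorphic_on UNIV"
    proof (rule leibniz_rule_holomorphic)
      show "((\<lambda>z. g t * E z t) has_field_derivative g t * (\<i> * complex_of_real t * E z t)) (at z within UNIV)" for z t
        unfolding E_def by (auto intro!: derivative_eq_intros)
      show "(\<lambda>t. g t * E z t) integrable_on cbox (-S) S" for z
        using intE[of 0 z] by simp
      have "continuous_on (UNIV \<times> cbox (-S) S) (\<lambda>(z, t). nderiv 0 g t * (\<i> * complex_of_real t * E z t))"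
        unfolding E_def case_prod_beta
        by (intro continuous_intros continuous_on_compose2[OF smooth_continuous_on[OF sm, of UNIV 0]]) auto
      then show "continuous_on (UNIV \<times> cbox (-S) S) (\<lambda>(z, t). g t * (\<i> * complex_of_real t * E z t))"
        by simp
    qed auto
    then show ?thesis
      by (simp add: F_def[abs_def])
  qed
  have step: "F (Suc n) z = - (\<i> * z) * F n z" for n z
  proof -
    have "((\<lambda>t. nderiv (Suc n) g t * E z t + nderiv n g t * (\<i> * z * E z t)) has_integral
        (nderiv n g S * E z S - nderiv n g (-S) * E z (-S))) {-S..S}"
    proof (rule fundamental_theorem_of_calculus)
      fix t :: real
      have "(E z has_vector_derivative \<i> * z * E z t) (at t within {-S..S})"
        unfolding E_def by (rule has_vector_derivative_real_field) (auto intro!: derivative_eq_intros)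
      then show "((\<lambda>t. nderiv n g t * E z t) has_vector_derivative
          nderiv (Suc n) g t * E z t + nderiv n g t * (\<i> * z * E z t)) (at t within {-S..S})"
        using has_vector_derivative_mult[OF has_vector_derivative_at_within[OF smooth_has_vector_derivative[OF sm, of n t]]]
        by (subst add.commute) blast
    qed (use S in auto)
    moreover have "nderiv n g S = 0" "nderiv n g (-S) = 0"
      by (rule nderiv_eq_0[OF _ test_space_on_support[OF gR]]; use SR in simp)+
    ultimately have "integral {-S..S} (\<lambda>t. nderiv (Suc n) g t * E z t + nderiv n g t * (\<i> * z * E z t)) = 0"
      by (simp add: integral_unique)
    moreover have "nderiv n g t * (\<i> * z * E z t) = (\<i> * z) * (nderiv n g t * E z t)" for t
      by simp
    ultimately have "integral {-S..S} (\<lambda>t. nderiv (Suc n) g t * E z t + (\<i> * z) * (nderiv n g t * E z t)) = 0"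
      by simp
    also have "integral {-S..S} (\<lambda>t. nderiv (Suc n) g t * E z t + (\<i> * z) * (nderiv n g t * E z t))
        = F (Suc n) z + \<i> * z * F n z"
      unfolding F_def by (subst integral_add) (auto intro: intE integrable_on_mult_right)
    finally show ?thesis
      by (simp add: eq_neg_iff_add_eq_0)
  qed
  have Fpow: "F n z = (- (\<i> * z)) ^ n * F 0 z" for n z
    by (induction n) (simp_all add: step)
  have bound: "\<exists>C\<ge>0. \<forall>z. norm (F n z) \<le> C * exp (S * \<bar>Im z\<bar>)" for n
  proof -
    have "bounded (nderiv n g ` {-S..S})"
      by (intro compact_imp_bounded compact_continuous_image smooth_continuous_on sm) auto
    then obtain M where M: "M > 0" "\<And>t. t \<in> {-S..S} \<Longrightarrow> norm (nderiv n g t) \<le> M"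
      by (auto simp: bounded_pos)
    have "norm (F n z) \<le> (M * exp (S * \<bar>Im z\<bar>)) * (S - (-S))" for z
      unfolding F_def
    proof (rule integral_bound)
      fix t assume t: "t \<in> {-S..S}"
      show "norm (nderiv n g t * E z t) \<le> M * exp (S * \<bar>Im z\<bar>)"
        unfolding norm_mult using M t normE[OF t] by (intro mult_mono) auto
    qed (use S in \<open>auto intro!: continuous_intros smooth_continuous_on sm contE\<close>)
    then show ?thesis
      using S M by (intro exI[of _ "M * (S + S)"]) (auto simp: algebra_simps)
  qed
  define c where "c = complex_of_real (1 / sqrt (2 * pi))"
  have "(\<lambda>x. c * F 0 (complex_of_real x)) \<in> Z_space"
  proof (rule Z_spaceI[OF _ S])
    fix n :: nat
    obtain C D where C: "C \<ge> 0" "\<And>z. norm (F 0 z) \<le> C * exp (S * \<bar>Im z\<bar>)"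
      and D: "D \<ge> 0" "\<And>z. norm (F n z) \<le> D * exp (S * \<bar>Im z\<bar>)"
      using bound[of 0] bound[of n] by blast
    have "norm (c * F 0 z) \<le> norm c * (2 ^ n * (C + D)) / (1 + norm z) ^ n * exp (S * \<bar>Im z\<bar>)" for z
    proof -
      have "(1 + norm z) ^ n * norm (F 0 z) \<le> 2 ^ n * (1 + norm z ^ n) * norm (F 0 z)"
        by (intro mult_right_mono one_plus_power_le) auto
      also have "\<dots> = 2 ^ n * (norm (F 0 z) + norm (F n z))"
        by (subst Fpow[of n]) (simp add: norm_mult norm_power distrib_right)
      also have "\<dots> \<le> 2 ^ n * (C * exp (S * \<bar>Im z\<bar>) + D * exp (S * \<bar>Im z\<bar>))"
        by (intro mult_left_mono add_mono C D) auto
      finally have "norm (F 0 z) \<le> 2 ^ n * (C + D) * exp (S * \<bar>Im z\<bar>) / (1 + norm z) ^ n"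
        by (subst pos_le_divide_eq) (auto simp: algebra_simps add_pos_nonneg)
      then have "norm c * norm (F 0 z) \<le> norm c * (2 ^ n * (C + D) * exp (S * \<bar>Im z\<bar>) / (1 + norm z) ^ n)"
        by (intro mult_left_mono) auto
      then show ?thesis
        by (simp add: norm_mult)
    qed
    then show "\<exists>C. \<forall>z. norm (c * F 0 z) \<le> C / (1 + norm z) ^ n * exp (S * \<bar>Im z\<bar>)"
      by blast
  qed (intro holomorphic_intros hol)
  moreover have "fourier_adj g x = c * F 0 (complex_of_real x)" for x
  proof -
    have "set_integrable lborel {-S..S} (\<lambda>t. nderiv 0 g t * E x t)"
      by (intro borel_integrable_atLeastAtMost' continuous_intros smooth_continuous_on sm contE)
    then have "F 0 x = (LINT t:{-S..S}|lborel. nderiv 0 g t * E x t)"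
      unfolding F_def by (rule set_borel_integral_eq_integral(2)[symmetric])
    also have "\<dots> = (LINT t|lborel. g t * exp (\<i> * complex_of_real (x * t)))"
      unfolding set_lebesgue_integral_def
    proof (rule Bochner_Integration.integral_cong)
      fix t
      have "t \<in> {-S..S}" if "g t \<noteq> 0"
        using test_space_on_support[OF gR] that by (auto simp: S_def)
      then show "indicat_real {-S..S} t *\<^sub>R (nderiv 0 g t * E x t) = g t * exp (\<i> * complex_of_real (x * t))"
        by (cases "g t = 0") (auto simp: E_def mult_ac)
    qed simp
    finally show ?thesis
      by (simp add: fourier_adj_def c_def)
  qed
  then have "fourier_adj g = (\<lambda>x. c * F 0 (complex_of_real x))"
    by (rule ext)
  ultimately show ?thesis
    by simp
qed

section \<open>Differentiation under the Fourier integral\<close>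

lemma integrable_inverse_square:
  fixes h :: "real \<Rightarrow> complex"
  assumes "continuous_on UNIV h" "\<And>x. norm (h x) \<le> C / (1 + x\<^sup>2)"
  shows "integrable lborel h"
proof (rule Bochner_Integration.integrable_bound)
  show "integrable lborel (\<lambda>x::real. C / (1 + x\<^sup>2))"
    using integrable_inverse_1_plus_square
    by (simp add: set_integrable_def divide_inverse einterval_eq_UNIV)
  show "h \<in> borel_measurable lborel"
    using borel_measurable_continuous_onI[OF assms(1)] by simp
  show "AE x in lborel. norm (h x) \<le> norm (C / (1 + x\<^sup>2))"
    using assms(2) by (intro AE_I2) (metis abs_ge_self order_trans real_norm_def)
qed

text \<open>Dominated convergence for the difference quotients. The Taylor remainder of the
  exponential is used in two forms: the bound 2 |h x| yields the integrable majorant 2 |x u(x)|, and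
  the bound |h x|^2 / 2 yields the pointwise limit.\<close>

lemma fourier_integral_has_vector_derivative:
  fixes u :: "real \<Rightarrow> complex"
  assumes u: "integrable lborel u" and xu: "integrable lborel (\<lambda>x. complex_of_real x * u x)"
  shows "((\<lambda>t. LINT x|lborel. u x * exp (\<i> * complex_of_real (t * x))) has_vector_derivative
    (LINT x|lborel. \<i> * (complex_of_real x * u x) * exp (\<i> * complex_of_real (t * x)))) (at t)"
proof -
  have u_meas [measurable]: "u \<in> borel_measurable borel"
    using borel_measurable_integrable[OF u] by simp
  have int: "integrable lborel (\<lambda>x. v x * exp (\<i> * complex_of_real (t * x)))"
    if "integrable lborel v" for v :: "real \<Rightarrow> complex" and t
  proof (rule Bochner_Integration.integrable_bound[OF that])
    have [measurable]: "v \<in> borel_measurable borel"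
      using borel_measurable_integrable[OF that] by simp
    show "(\<lambda>x. v x * exp (\<i> * complex_of_real (t * x))) \<in> borel_measurable lborel"
      by measurable
  qed (simp add: norm_mult)
  define F where "F t = (LINT x|lborel. u x * exp (\<i> * complex_of_real (t * x)))" for t
  define D where "D = (LINT x|lborel. \<i> * (complex_of_real x * u x) * exp (\<i> * complex_of_real (t * x)))"
  \<comment> \<open>The integrand of the difference quotient minus the proposed derivative, so that
    its integral is exactly the error to be shown small.\<close>
  define Q where "Q h x = u x * exp (\<i> * complex_of_real (t * x)) *
      ((exp (\<i> * complex_of_real (h * x)) - (1 + \<i> * complex_of_real (h * x))) / complex_of_real h)" for h x
  have normQ: "norm (Q h x) = norm (u x) *
      norm ((exp (\<i> * complex_of_real (h * x)) - (1 + \<i> * complex_of_real (h * x))) / complex_of_real h)" for h x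
    unfolding Q_def norm_mult norm_exp_i_times by simp
  have diff: "norm (F (t + h) - F t - h *\<^sub>R D) / norm h = norm (LINT x|lborel. Q h x)" if "h \<noteq> 0" for h
  proof -
    have e: "exp (\<i> * complex_of_real ((t + h) * x)) =
        exp (\<i> * complex_of_real (t * x)) * exp (\<i> * complex_of_real (h * x))" for x
      by (simp add: distrib_right distrib_left exp_add)
    note i12 = Bochner_Integration.integrable_diff[OF int[OF u, of "t + h"] int[OF u, of t]]
    have i3: "integrable lborel (\<lambda>x. \<i> * (complex_of_real x * u x) * exp (\<i> * complex_of_real (t * x)))"
      by (intro int integrable_mult_right xu)
    have alg: "U * a * ((b - (1 + \<i> * (H * X))) / H) = (U * (a * b) - U * a - H * (\<i> * (X * U) * a)) / H"
      for U a b H X :: complex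
      by (simp add: algebra_simps)
    have "(LINT x|lborel. Q h x) = (LINT x|lborel. (u x * exp (\<i> * complex_of_real ((t + h) * x)) -
        u x * exp (\<i> * complex_of_real (t * x)) -
        h *\<^sub>R (\<i> * (complex_of_real x * u x) * exp (\<i> * complex_of_real (t * x)))) / complex_of_real h)"
      unfolding Q_def e unfolding scaleR_conv_of_real of_real_mult alg ..
    also have "\<dots> = (F (t + h) - F t - h *\<^sub>R D) / complex_of_real h"
      unfolding F_def D_def integral_divide_zero
      by (simp only: integral_scaleR_right Bochner_Integration.integral_diff[OF i12 integrable_scaleR_right[OF i3]]
          Bochner_Integration.integral_diff[OF int[OF u] int[OF u]])
    finally show ?thesis
      by (simp add: norm_divide)
  qed
  have "((\<lambda>h. norm (LINT x|lborel. Q h x)) \<longlongrightarrow> 0) (at 0)"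
    unfolding tendsto_at_iff_sequentially comp_def
  proof (intro allI impI)
    fix X :: "nat \<Rightarrow> real"
    assume X0: "\<forall>i. X i \<in> UNIV - {0}" and X: "X \<longlonglongrightarrow> 0"
    have "(\<lambda>n. LINT x|lborel. Q (X n) x) \<longlonglongrightarrow> (LINT x|(lborel :: real measure). (0::complex))"
    proof (rule integral_dominated_convergence)
      show "integrable lborel (\<lambda>x. 2 * norm (complex_of_real x * u x))"
        by (intro integrable_mult_right integrable_norm xu)
      show "AE x in lborel. norm (Q (X n) x) \<le> 2 * norm (complex_of_real x * u x)" for n
      proof (rule AE_I2)
        fix x :: real
        have "norm (exp (\<i> * complex_of_real (X n * x)) - (1 + \<i> * complex_of_real (X n * x))) \<le> 2 * \<bar>X n * x\<bar>"
          using iexp_approx2[of "X n * x" 1] by simp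
        then have "norm ((exp (\<i> * complex_of_real (X n * x)) - (1 + \<i> * complex_of_real (X n * x))) / complex_of_real (X n)) \<le> 2 * \<bar>x\<bar>"
          using X0 by (simp add: norm_divide abs_mult field_simps)
        then have "norm (u x) * norm ((exp (\<i> * complex_of_real (X n * x)) - (1 + \<i> * complex_of_real (X n * x))) / complex_of_real (X n)) \<le> norm (u x) * (2 * \<bar>x\<bar>)"
          by (intro mult_left_mono) auto
        then show "norm (Q (X n) x) \<le> 2 * norm (complex_of_real x * u x)"
          unfolding normQ by (simp add: norm_mult mult_ac)
      qed
      show "AE x in lborel. (\<lambda>n. Q (X n) x) \<longlonglongrightarrow> 0"
      proof (rule AE_I2, rule Lim_null_comparison, rule always_eventually, rule allI)
        fix x :: real and n
        have "norm (exp (\<i> * complex_of_real (X n * x)) - (1 + \<i> * complex_of_real (X n * x))) \<le> \<bar>X n * x\<bar>\<^sup>2 / 2"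
          using iexp_approx1[of "X n * x" 1] by (simp add: numeral_2_eq_2)
        then have "norm ((exp (\<i> * complex_of_real (X n * x)) - (1 + \<i> * complex_of_real (X n * x))) / complex_of_real (X n)) \<le> x\<^sup>2 / 2 * \<bar>X n\<bar>"
          using X0 by (simp add: norm_divide abs_mult field_simps power2_eq_square)
        then have "norm (u x) * norm ((exp (\<i> * complex_of_real (X n * x)) - (1 + \<i> * complex_of_real (X n * x))) / complex_of_real (X n)) \<le> norm (u x) * (x\<^sup>2 / 2 * \<bar>X n\<bar>)"
          by (intro mult_left_mono) auto
        then show "norm (Q (X n) x) \<le> norm (u x) * (x\<^sup>2 / 2 * \<bar>X n\<bar>)"
          unfolding normQ .
      next
        fix x :: real
        show "(\<lambda>n. norm (u x) * (x\<^sup>2 / 2 * \<bar>X n\<bar>)) \<longlonglongrightarrow> 0"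
          using tendsto_mult[OF tendsto_const tendsto_mult[OF tendsto_const tendsto_rabs[OF X]],
              of "norm (u x)" "x\<^sup>2 / 2"] by simp
      qed
    qed (auto simp: Q_def)
    then show "(\<lambda>n. norm (LINT x|lborel. Q (X n) x)) \<longlonglongrightarrow> 0"
      using tendsto_norm_zero by simp
  qed
  then have "((\<lambda>h. norm (F (t + h) - F t - h *\<^sub>R D) / norm h) \<longlongrightarrow> 0) (at 0)"
    by (rule Lim_transform_eventually) (auto simp: eventually_at_filter diff[unfolded real_norm_def] intro!: always_eventually)
  then have "(F has_vector_derivative D) (at t)"
    unfolding has_vector_derivative_def has_derivative_at by (simp add: bounded_linear_scaleR_left)
  then show ?thesis
    by (simp add: F_def[abs_def] D_def)
qed

section \<open>Fourier inversion by Gaussian summation\<close>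

lemma integrable_gaussian: "integrable lborel (\<lambda>x::real. exp (- x\<^sup>2 / 2))"
  using integrable_mult_right[OF integrable_std_normal_moment[of 0], of "sqrt (2 * pi)"]
  by (simp add: std_normal_density_def)

text \<open>This is the characteristic function of the standard normal law, freed of the constant in
  its density.\<close>

lemma fourier_gaussian:
  "(LINT x|lborel. complex_of_real (exp (- x\<^sup>2 / 2)) * exp (\<i> * complex_of_real (t * x)))
    = complex_of_real (sqrt (2 * pi) * exp (- t\<^sup>2 / 2))"
proof -
  have "complex_of_real (exp (- t\<^sup>2 / 2)) = char std_normal_distribution t"
    by (simp add: char_std_normal_distribution)
  also have "\<dots> = (LINT x|lborel. std_normal_density x *\<^sub>R exp (\<i> * complex_of_real (t * x)))"
    unfolding char_def by (subst integral_density) (auto simp: normal_density_nonneg)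
  also have "\<dots> = (LINT x|lborel. complex_of_real (1 / sqrt (2 * pi)) *
      (complex_of_real (exp (- x\<^sup>2 / 2)) * exp (\<i> * complex_of_real (t * x))))"
    by (intro Bochner_Integration.integral_cong) (auto simp: std_normal_density_def scaleR_conv_of_real)
  also have "\<dots> = complex_of_real (1 / sqrt (2 * pi)) *
      (LINT x|lborel. complex_of_real (exp (- x\<^sup>2 / 2)) * exp (\<i> * complex_of_real (t * x)))"
    by simp
  finally have eq: "complex_of_real (exp (- t\<^sup>2 / 2)) = complex_of_real (1 / sqrt (2 * pi)) *
      (LINT x|lborel. complex_of_real (exp (- x\<^sup>2 / 2)) * exp (\<i> * complex_of_real (t * x)))" .
  have "complex_of_real (sqrt (2 * pi)) * complex_of_real (1 / sqrt (2 * pi)) = 1"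
    unfolding of_real_mult[symmetric] by simp
  then show ?thesis
    unfolding of_real_mult eq mult.assoc[symmetric] by simp
qed

text \<open>The hypotheses describe a class that contains both the test functions and the functions
  in \<open>Z_space\<close>, so that one proof serves both. The unregularised double integral does
  not converge absolutely, since the exponentials have modulus 1; the Gaussian factor makes Fubini
  applicable.\<close>

lemma fourier_adj_fourier:
  fixes f :: "real \<Rightarrow> complex"
  assumes cont: "continuous_on UNIV f" and M: "\<And>x. norm (f x) \<le> M"
    and f: "integrable lborel f" and ff: "integrable lborel (fourier f)"
  shows "fourier_adj (fourier f) x = f x"
proof -
  define c where "c = complex_of_real (1 / sqrt (2 * pi))"
  have c: "c * c * complex_of_real (2 * pi) = 1"
    unfolding c_def of_real_mult[symmetric] by (simp add: field_simps)
  define h where "h \<xi> = (LINT y|lborel. f y * exp (- \<i> * complex_of_real (y * \<xi>)))" for \<xi>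
  have h_fourier: "fourier f = (\<lambda>\<xi>. c * h \<xi>)"
    by (simp add: fourier_def[abs_def] c_def h_def)
  have "integrable lborel (\<lambda>\<xi>. (1 / c) * (c * h \<xi>))"
    using ff unfolding h_fourier by (rule integrable_mult_right)
  then have h: "integrable lborel h"
    by (simp add: c_def)
  have [measurable]: "f \<in> borel_measurable borel" "h \<in> borel_measurable borel"
    using borel_measurable_integrable[OF f] borel_measurable_integrable[OF h] by simp_all
  define g where "g u = complex_of_real (exp (- u\<^sup>2 / 2))" for u
  have g: "integrable lborel g"
    unfolding g_def by (rule integrable_of_real[OF integrable_gaussian])
  have normg: "norm (g u) \<le> 1" for u
    by (simp add: g_def)
  have contg: "isCont g u" for u
    unfolding g_def by (intro continuous_intros) auto
  have [measurable]: "g \<in> borel_measurable borel"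
    using borel_measurable_integrable[OF g] by simp
  \<comment> \<open>The inversion integral with a Gaussian cut-off of width \<open>n\<close>, evaluated by Fubini as a
    convolution with an approximate identity.\<close>
  define J where "J n = (LINT \<xi>|lborel. h \<xi> * exp (\<i> * complex_of_real (x * \<xi>)) * g (\<xi> / n))" for n
  have J: "J n = complex_of_real (sqrt (2 * pi)) * (LINT u|lborel. f (x + u / n) * g u)" if n: "n > 0" for n :: real
  proof -
    define k where "k \<xi> y = f y * exp (- \<i> * complex_of_real (y * \<xi>)) * exp (\<i> * complex_of_real (x * \<xi>)) * g (\<xi> / n)" for \<xi> y
    have gn: "integrable lborel (\<lambda>\<xi>. g (\<xi> / n))"
      using lborel_integrable_real_affine[OF g, of "1 / n" 0] n by simp
    have normk: "norm (k \<xi> y) = norm (g (\<xi> / n)) * norm (f y)" for \<xi> y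
      by (simp add: k_def norm_mult)
    have [measurable]: "case_prod k \<in> borel_measurable (lborel \<Otimes>\<^sub>M lborel)"
      unfolding k_def[abs_def] by measurable
    have "integrable (lborel \<Otimes>\<^sub>M lborel) (case_prod k)"
    proof (rule lborel_pair.Fubini_integrable)
      show "integrable lborel (\<lambda>\<xi>. LINT y|lborel. norm (case (\<xi>, y) of (\<xi>, y) \<Rightarrow> k \<xi> y))"
        using gn f by (simp add: normk)
      show "AE \<xi> in lborel. integrable lborel (\<lambda>y. case (\<xi>, y) of (\<xi>, y) \<Rightarrow> k \<xi> y)"
      proof (rule AE_I2)
        fix \<xi> :: real
        have "integrable lborel (k \<xi>)"
        proof (rule Bochner_Integration.integrable_bound)
          show "integrable lborel (\<lambda>y. norm (g (\<xi> / n)) * norm (f y))"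
            using f by simp
          show "k \<xi> \<in> borel_measurable lborel"
            unfolding k_def[abs_def] by measurable
        qed (simp add: normk)
        then show "integrable lborel (\<lambda>y. case (\<xi>, y) of (\<xi>, y) \<Rightarrow> k \<xi> y)"
          by simp
      qed
    qed simp
    then have "(LINT y|lborel. LINT \<xi>|lborel. k \<xi> y) = (LINT \<xi>|lborel. LINT y|lborel. k \<xi> y)"
      by (rule lborel_pair.Fubini_integral)
    also have "\<dots> = J n"
      unfolding J_def h_def k_def by simp
    finally have Jk: "J n = (LINT y|lborel. LINT \<xi>|lborel. k \<xi> y)" ..
    have inner: "(LINT \<xi>|lborel. k \<xi> y) = f y * (n * (sqrt (2 * pi) * exp (- (n * (x - y))\<^sup>2 / 2)))" for y
    proof -
      have kn: "k (n * \<eta>) y = f y * (g \<eta> * exp (\<i> * complex_of_real ((n * (x - y)) * \<eta>)))" for \<eta>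
      proof -
        have "exp (- \<i> * complex_of_real (y * (n * \<eta>))) * exp (\<i> * complex_of_real (x * (n * \<eta>)))
            = exp (\<i> * complex_of_real ((n * (x - y)) * \<eta>))"
          unfolding exp_add[symmetric] by (rule arg_cong[where f=exp]) (simp add: algebra_simps)
        then show ?thesis
          using n by (simp add: k_def mult_ac)
      qed
      have "(LINT \<xi>|lborel. k \<xi> y) = n *\<^sub>R (LINT \<eta>|lborel. k (n * \<eta>) y)"
        using n lborel_integral_real_affine[of n "\<lambda>\<xi>. k \<xi> y" 0] by simp
      also have "(LINT \<eta>|lborel. k (n * \<eta>) y)
          = f y * (sqrt (2 * pi) * exp (- (n * (x - y))\<^sup>2 / 2))"
        unfolding kn integral_mult_right_zero g_def fourier_gaussian by simp
      finally show ?thesis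
        by (simp add: scaleR_conv_of_real)
    qed
    have "J n = (LINT y|lborel. f y * (n * (sqrt (2 * pi) * exp (- (n * (x - y))\<^sup>2 / 2))))"
      unfolding Jk inner by simp
    \<comment> \<open>The substitution y = x + u / n moves the dependence on n from the Gaussian
      into the argument of \<open>f\<close>, where continuity at x decides the limit.\<close>
    also have "(LINT y|lborel. f y * (n * (sqrt (2 * pi) * exp (- (n * (x - y))\<^sup>2 / 2)))) =
        (1 / n) *\<^sub>R (LINT u|lborel. f (x + 1 / n * u) * (n * (sqrt (2 * pi) * exp (- (n * (x - (x + 1 / n * u)))\<^sup>2 / 2))))"
      using n by (subst lborel_integral_real_affine[of "1 / n" _ x]) simp_all
    also have "(LINT u|lborel. f (x + 1 / n * u) * (n * (sqrt (2 * pi) * exp (- (n * (x - (x + 1 / n * u)))\<^sup>2 / 2)))) =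
        (LINT u|lborel. complex_of_real (n * sqrt (2 * pi)) * (f (x + u / n) * g u))"
    proof (rule Bochner_Integration.integral_cong)
      fix u
      have "n * (x - (x + 1 / n * u)) = - u"
        using n by simp
      then show "f (x + 1 / n * u) * (n * (sqrt (2 * pi) * exp (- (n * (x - (x + 1 / n * u)))\<^sup>2 / 2))) =
          complex_of_real (n * sqrt (2 * pi)) * (f (x + u / n) * g u)"
        by (simp add: g_def)
    qed simp
    also have "(1 / n) *\<^sub>R \<dots> = complex_of_real (sqrt (2 * pi)) * (LINT u|lborel. f (x + u / n) * g u)"
      unfolding integral_mult_right_zero using n by (simp add: scaleR_conv_of_real)
    finally show ?thesis .
  qed
  \<comment> \<open>The same sequence is given two limits: here the cut-off tends to 1 under the
    majorant \<open>norm (h \<xi>)\<close>, below the convolution concentrates at x. The index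
    \<open>Suc n\<close> keeps the width positive, as the formula for \<open>J\<close>
    requires.\<close>
  have "(\<lambda>n. J (real (Suc n))) \<longlonglongrightarrow> (LINT \<xi>|lborel. h \<xi> * exp (\<i> * complex_of_real (x * \<xi>)))"
    unfolding J_def
  proof (rule integral_dominated_convergence)
    show "integrable lborel (\<lambda>\<xi>. norm (h \<xi>))"
      using h by simp
    show "AE \<xi> in lborel. (\<lambda>n. h \<xi> * exp (\<i> * complex_of_real (x * \<xi>)) * g (\<xi> / real (Suc n)))
        \<longlonglongrightarrow> h \<xi> * exp (\<i> * complex_of_real (x * \<xi>))"
    proof (rule AE_I2)
      fix \<xi> :: real
      have "(\<lambda>n. \<xi> / real (Suc n)) \<longlonglongrightarrow> 0"
        by (rule LIMSEQ_Suc[OF lim_const_over_n])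
      then have "(\<lambda>n. g (\<xi> / real (Suc n))) \<longlonglongrightarrow> g 0"
        by (rule isCont_tendsto_compose[OF contg])
      then have "(\<lambda>n. h \<xi> * exp (\<i> * complex_of_real (x * \<xi>)) * g (\<xi> / real (Suc n)))
          \<longlonglongrightarrow> h \<xi> * exp (\<i> * complex_of_real (x * \<xi>)) * g 0"
        by (intro tendsto_mult tendsto_const)
      then show "(\<lambda>n. h \<xi> * exp (\<i> * complex_of_real (x * \<xi>)) * g (\<xi> / real (Suc n)))
          \<longlonglongrightarrow> h \<xi> * exp (\<i> * complex_of_real (x * \<xi>))"
        by (simp add: g_def)
    qed
    show "AE \<xi> in lborel. norm (h \<xi> * exp (\<i> * complex_of_real (x * \<xi>)) * g (\<xi> / real (Suc n))) \<le> norm (h \<xi>)" for n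
      using normg by (auto simp: norm_mult intro!: mult_left_le)
  qed measurable
  \<comment> \<open>One factor \<open>sqrt (2 * pi)\<close> comes from the transform of the
    Gaussian, the other is its total mass. Their product cancels the two normalising constants
    \<open>c\<close>.\<close>
  moreover have "(\<lambda>n. J (real (Suc n))) \<longlonglongrightarrow> complex_of_real (sqrt (2 * pi)) * (f x * complex_of_real (sqrt (2 * pi)))"
  proof -
    have "(\<lambda>n. LINT u|lborel. f (x + u / real (Suc n)) * g u) \<longlonglongrightarrow> (LINT u|lborel. f x * g u)"
    proof (rule integral_dominated_convergence)
      show "integrable lborel (\<lambda>u. M * norm (g u))"
        using g by simp
      show "AE u in lborel. (\<lambda>n. f (x + u / real (Suc n)) * g u) \<longlonglongrightarrow> f x * g u"
      proof (rule AE_I2)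
        fix u :: real
        have "(\<lambda>n. x + u / real (Suc n)) \<longlonglongrightarrow> x + 0"
          by (intro tendsto_add tendsto_const LIMSEQ_Suc[OF lim_const_over_n])
        moreover have "isCont f (x + 0)"
          using cont by (simp add: continuous_on_eq_continuous_at)
        ultimately have "(\<lambda>n. f (x + u / real (Suc n))) \<longlonglongrightarrow> f (x + 0)"
          by (rule isCont_tendsto_compose[rotated])
        then show "(\<lambda>n. f (x + u / real (Suc n)) * g u) \<longlonglongrightarrow> f x * g u"
          by (intro tendsto_mult tendsto_const) simp
      qed
      show "AE u in lborel. norm (f (x + u / real (Suc n)) * g u) \<le> M * norm (g u)" for n
        using M by (auto simp: norm_mult intro!: mult_right_mono)
    qed measurable
    moreover have "(LINT u|lborel. f x * g u) = f x * complex_of_real (sqrt (2 * pi))"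
      using fourier_gaussian[of 0] by (simp add: g_def)
    ultimately have "(\<lambda>n. LINT u|lborel. f (x + u / real (Suc n)) * g u)
        \<longlonglongrightarrow> f x * complex_of_real (sqrt (2 * pi))"
      by (simp only:)
    then have "(\<lambda>n. complex_of_real (sqrt (2 * pi)) * (LINT u|lborel. f (x + u / real (Suc n)) * g u))
        \<longlonglongrightarrow> complex_of_real (sqrt (2 * pi)) * (f x * complex_of_real (sqrt (2 * pi)))"
      by (intro tendsto_mult tendsto_const)
    then show ?thesis
      by (simp only: J of_nat_0_less_iff zero_less_Suc)
  qed
  ultimately have "(LINT \<xi>|lborel. h \<xi> * exp (\<i> * complex_of_real (x * \<xi>))) =
      complex_of_real (sqrt (2 * pi)) * (f x * complex_of_real (sqrt (2 * pi)))"
    by (rule LIMSEQ_unique)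
  also have "\<dots> = complex_of_real (2 * pi) * f x"
  proof -
    have "complex_of_real (sqrt (2 * pi)) * complex_of_real (sqrt (2 * pi)) = complex_of_real (2 * pi)"
      unfolding of_real_mult[symmetric] by simp
    then show ?thesis
      by (metis mult.assoc mult.commute)
  qed
  finally have "(LINT \<xi>|lborel. h \<xi> * exp (\<i> * complex_of_real (x * \<xi>))) = complex_of_real (2 * pi) * f x" .
  then have "fourier_adj (fourier f) x = c * (c * (complex_of_real (2 * pi) * f x))"
    unfolding fourier_adj_def h_fourier c_def[symmetric] by (simp add: mult.assoc)
  also have "\<dots> = f x"
    using c by (metis mult.assoc mult_1)
  finally show ?thesis .
qed

section \<open>The converse half of Paley--Wiener\<close>

lemma fourier_eq_fourier_adj: "fourier u \<xi> = fourier_adj u (- \<xi>)"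
  by (simp add: fourier_def fourier_adj_def mult.commute)

lemma fourier_adj_reflect: "fourier_adj (\<lambda>x. u (- x)) \<xi> = fourier_adj u (- \<xi>)"
proof -
  have "(LINT x|lborel. u (- x) * exp (\<i> * complex_of_real (\<xi> * x)))
      = (LINT x|lborel. u x * exp (\<i> * complex_of_real (- \<xi> * x)))"
    using lborel_integral_real_affine[of "-1" "\<lambda>x. u (- x) * exp (\<i> * complex_of_real (\<xi> * x))" 0]
    by simp
  then show ?thesis
    by (simp add: fourier_adj_def)
qed

text \<open>The line of integration is moved to \<open>Im z = y\<close> and then \<open>y\<close> tends to infinity. The shift uses a
  primitive of the integrand in place of a contour.\<close>

lemma fourier_integral_eq_0:
  assumes hol: "f holomorphic_on UNIV"
    and bound: "\<And>z. norm (f z) \<le> C / (1 + norm z) ^ 2 * exp (r * \<bar>Im z\<bar>)"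
    and t: "t > r"
  shows "(LINT x|lborel. f (complex_of_real x) * exp (\<i> * complex_of_real (t * x))) = 0"
proof -
  define G where "G z = f z * exp (\<i> * (complex_of_real t * z))" for z
  have holG: "G holomorphic_on UNIV"
    unfolding G_def[abs_def] by (intro holomorphic_intros hol)
  then obtain H where H: "\<And>z. (H has_field_derivative G z) (at z)"
    using holomorphic_convex_primitive'[of UNIV G] by auto
  have "0 \<le> C / (1 + norm (0::complex)) ^ 2 * exp (r * \<bar>Im 0\<bar>)"
    by (rule order_trans[OF norm_ge_zero bound])
  then have C0: "C \<ge> 0"
    by simp
  \<comment> \<open>Weakening the weight from |z| to |Re z| gives one integrable majorant for all
    horizontal lines in the upper half-plane; the height survives only in the exponential.\<close>
  have normG: "norm (G z) \<le> C / (1 + (Re z)\<^sup>2) * exp ((r - t) * Im z)" if "Im z \<ge> 0" for z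
  proof -
    have "(Re z)\<^sup>2 \<le> (norm z)\<^sup>2"
      by (simp add: cmod_power2)
    then have "1 + (Re z)\<^sup>2 \<le> (1 + norm z) ^ 2"
      by (simp add: power2_sum add_increasing2)
    then have "C / (1 + norm z) ^ 2 \<le> C / (1 + (Re z)\<^sup>2)"
      using C0 by (intro divide_left_mono) (auto intro!: mult_pos_pos zero_less_power add_pos_nonneg)
    from order_trans[OF bound[of z] mult_right_mono[OF this exp_ge_zero]] that
    have "norm (f z) \<le> C / (1 + (Re z)\<^sup>2) * exp (r * Im z)"
      by simp
    from mult_right_mono[OF this exp_ge_zero]
    have "norm (G z) \<le> C / (1 + (Re z)\<^sup>2) * exp (r * Im z) * exp (- (t * Im z))"
      unfolding G_def norm_mult by simp
    also have "\<dots> = C / (1 + (Re z)\<^sup>2) * exp ((r - t) * Im z)"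
      unfolding mult.assoc exp_add[symmetric] by (simp add: algebra_simps)
    finally show ?thesis .
  qed
  have exp_le: "exp ((r - t) * y) \<le> 1" if "y \<ge> 0" for y
    using t that by (simp add: mult_nonpos_nonneg)
  have normG': "norm (G z) \<le> C / (1 + (Re z)\<^sup>2)" if "Im z \<ge> 0" for z
  proof -
    have "C / (1 + (Re z)\<^sup>2) * exp ((r - t) * Im z) \<le> C / (1 + (Re z)\<^sup>2) * 1"
      using C0 exp_le[OF that] by (intro mult_left_mono) auto
    then show ?thesis
      using normG[OF that] by simp
  qed
  define L where "L y x = G (complex_of_real x + \<i> * complex_of_real y)" for y x
  have contL: "continuous_on S (L y)" for y S
    unfolding L_def
    by (intro continuous_on_compose2[OF holomorphic_on_imp_continuous_on[OF holG]] continuous_intros) auto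
  have normL: "norm (L y x) \<le> C / (1 + x\<^sup>2)" if "y \<ge> 0" for y x
    using normG'[of "complex_of_real x + \<i> * complex_of_real y"] that by (simp add: L_def)
  have intL: "integrable lborel (L y)" if "y \<ge> 0" for y
    by (rule integrable_inverse_square[OF contL normL[OF that]])
  have meas [measurable]: "L y \<in> borel_measurable borel" for y
    by (rule borel_measurable_continuous_onI[OF contL])
  have intC: "integrable lborel (\<lambda>x::real. C / (1 + x\<^sup>2))"
    using integrable_inverse_1_plus_square
    by (simp add: set_integrable_def divide_inverse einterval_eq_UNIV)
  \<comment> \<open>The truncated integrals are the horizontal sides of a rectangle;
    \<open>P_H\<close> expresses them by the primitive at its corners.\<close>
  define P where "P n y = (LINT x|lborel. indicat_real {- real n..real n} x *\<^sub>R L y x)" for n y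
  have P_lim: "(\<lambda>n. P n y) \<longlonglongrightarrow> (LINT x|lborel. L y x)" if "y \<ge> 0" for y
    unfolding P_def
  proof (rule integral_dominated_convergence[OF _ _ intC])
    show "AE x in lborel. (\<lambda>n. indicat_real {- real n..real n} x *\<^sub>R L y x) \<longlonglongrightarrow> L y x"
    proof (rule AE_I2, rule tendsto_eventually)
      fix x :: real
      obtain N where "\<bar>x\<bar> \<le> real N"
        using real_arch_simple by blast
      then have "indicat_real {- real n..real n} x *\<^sub>R L y x = L y x" if "n \<ge> N" for n
        using that by (auto simp: indicator_def)
      then show "\<forall>\<^sub>F n in sequentially. indicat_real {- real n..real n} x *\<^sub>R L y x = L y x"
        by (auto simp: eventually_sequentially)
    qed
    show "AE x in lborel. norm (indicat_real {- real n..real n} x *\<^sub>R L y x) \<le> C / (1 + x\<^sup>2)" for n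
      using normL[OF that] C0 by (intro AE_I2) (auto simp: indicator_def)
  qed measurable
  have P_H: "P n y = H (of_nat n + \<i> * complex_of_real y) - H (- of_nat n + \<i> * complex_of_real y)" for n y
  proof -
    have "((\<lambda>x. H (complex_of_real x + \<i> * complex_of_real y)) has_vector_derivative L y x) (at x within S)" for x S
      using H unfolding L_def
      by (intro has_vector_derivative_real_field) (simp add: DERIV_shift[symmetric])
    from integral_FTC_atLeastAtMost[OF _ this contL, of "- real n" "real n"]
    show ?thesis
      by (simp add: P_def)
  qed
  \<comment> \<open>This replaces the vertical sides: the convex set below is the ray Re z = a, Im z
    \<ge> 0, on which the derivative of \<open>H\<close> is at most C / (1 + a^2). For a = n and a =
    -n the contribution vanishes in the limit.\<close>
  have H_diff: "norm (H (complex_of_real a + \<i> * complex_of_real y) - H (complex_of_real a)) \<le> C / (1 + a\<^sup>2) * y"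
    if "y \<ge> 0" for a y
  proof -
    have "norm (H (complex_of_real a + \<i> * complex_of_real y) - H (complex_of_real a))
        \<le> C / (1 + a\<^sup>2) * norm (complex_of_real a + \<i> * complex_of_real y - complex_of_real a)"
    proof (rule field_differentiable_bound)
      show "convex ({z. Re z \<le> a} \<inter> {z. Re z \<ge> a} \<inter> {z. Im z \<ge> 0})"
        by (intro convex_Int convex_halfspace_Re_le convex_halfspace_Re_ge convex_halfspace_Im_ge)
      show "norm (G z) \<le> C / (1 + a\<^sup>2)" if "z \<in> {z. Re z \<le> a} \<inter> {z. Re z \<ge> a} \<inter> {z. Im z \<ge> 0}" for z
      proof -
        have "Re z = a" "Im z \<ge> 0"
          using that by auto
        then show ?thesis
          using normG'[of z] by simp
      qed
    qed (use that H in \<open>auto intro: has_field_derivative_at_within\<close>)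
    then show ?thesis
      using that by (simp add: norm_mult)
  qed
  have shift: "(LINT x|lborel. L y x) = (LINT x|lborel. L 0 x)" if y: "y \<ge> 0" for y
  proof -
    have "norm (P n y - P n 0) \<le> 2 * C * y * inverse (real n)" if n: "n > 0" for n
    proof -
      have "P n y - P n 0 = (H (complex_of_real (real n) + \<i> * complex_of_real y) - H (complex_of_real (real n)))
          - (H (complex_of_real (- real n) + \<i> * complex_of_real y) - H (complex_of_real (- real n)))"
        by (simp add: P_H)
      also have "norm \<dots> \<le> C / (1 + (real n)\<^sup>2) * y + C / (1 + (- real n)\<^sup>2) * y"
        by (intro order_trans[OF norm_triangle_ineq4] add_mono H_diff y)
      also have "\<dots> = 2 * C * y * inverse (1 + (real n)\<^sup>2)"
        by (simp add: divide_inverse)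
      also have "\<dots> \<le> 2 * C * y * inverse (real n)"
      proof (rule mult_left_mono)
        have "real n * 1 \<le> real n * real n"
          using n by (intro mult_left_mono) auto
        then have "real n \<le> 1 + (real n)\<^sup>2"
          unfolding power2_eq_square by linarith
        then show "inverse (1 + (real n)\<^sup>2) \<le> inverse (real n)"
          using n by (intro le_imp_inverse_le) auto
      qed (use C0 y in auto)
      finally show ?thesis .
    qed
    then have "\<forall>\<^sub>F n in sequentially. norm (P n y - P n 0) \<le> 2 * C * y * inverse (real n)"
      by (auto simp: eventually_sequentially intro!: exI[of _ 1])
    moreover have "(\<lambda>n. 2 * C * y * inverse (real n)) \<longlonglongrightarrow> 0"
      using tendsto_mult[OF tendsto_const[of "2 * C * y"] lim_inverse_n] by simp
    ultimately have "(\<lambda>n. P n y - P n 0) \<longlonglongrightarrow> 0"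
      by (rule Lim_null_comparison)
    moreover have "(\<lambda>n. P n y - P n 0) \<longlonglongrightarrow> (LINT x|lborel. L y x) - (LINT x|lborel. L 0 x)"
      using y by (intro tendsto_diff P_lim) auto
    ultimately have "(LINT x|lborel. L y x) - (LINT x|lborel. L 0 x) = 0"
      using LIMSEQ_unique by blast
    then show ?thesis
      by simp
  qed
  define K where "K = (LINT x|(lborel :: real measure). C / (1 + x\<^sup>2))"
  \<comment> \<open>The integral does not depend on the height, so it may be estimated at height n;
    the resulting factor tends to 0 because r < t.\<close>
  have "norm (LINT x|lborel. L 0 x) \<le> K * exp (r - t) ^ n" for n
  proof -
    have "norm (LINT x|lborel. L (real n) x) \<le> (LINT x|(lborel :: real measure). C / (1 + x\<^sup>2) * exp (r - t) ^ n)"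
    proof (rule Bochner_Integration.integral_norm_bound_integral)
      fix x :: real
      show "norm (L (real n) x) \<le> C / (1 + x\<^sup>2) * exp (r - t) ^ n"
        using normG[of "complex_of_real x + \<i> * complex_of_real (real n)"]
        by (simp add: L_def exp_of_nat_mult[symmetric] mult.commute)
    qed (auto intro: intL intC simp del: times_divide_eq_left)
    also have "\<dots> = K * exp (r - t) ^ n"
      unfolding K_def by (rule integral_mult_left_zero)
    finally show ?thesis
      using shift[of "real n"] by simp
  qed
  moreover have "(\<lambda>n. K * exp (r - t) ^ n) \<longlonglongrightarrow> K * 0"
    using t by (intro tendsto_mult tendsto_const LIMSEQ_realpow_zero) auto
  ultimately have "norm (LINT x|lborel. L 0 x) \<le> K * 0"
    by (intro LIMSEQ_le_const) auto
  then have "(LINT x|lborel. L 0 x) = 0"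
    by simp
  then show ?thesis
    by (simp add: L_def G_def)
qed

lemma Z_space_decay:
  assumes "\<phi> \<in> Z_space"
  shows Z_space_integrable_power: "integrable lborel (\<lambda>x. complex_of_real x ^ k * \<phi> x)"
    and Z_space_bounded: "\<exists>M. \<forall>x. norm (\<phi> x) \<le> M"
    and Z_space_continuous_on: "continuous_on S \<phi>"
proof -
  obtain f r where f: "f holomorphic_on UNIV" "\<And>x. f (complex_of_real x) = \<phi> x"
    and bound: "\<And>n::nat. \<exists>C. \<forall>z. norm (f z) \<le> C / (1 + norm z) ^ n * exp (r * \<bar>Im z\<bar>)"
    using assms unfolding Z_space_def by blast
  have decay: "\<exists>C\<ge>0. \<forall>x. norm (\<phi> x) \<le> C / (1 + \<bar>x\<bar>) ^ n" for n
  proof -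
    obtain C where C: "\<And>z. norm (f z) \<le> C / (1 + norm z) ^ n * exp (r * \<bar>Im z\<bar>)"
      using bound by blast
    have "0 \<le> C / (1 + norm (0::complex)) ^ n * exp (r * \<bar>Im 0\<bar>)"
      by (rule order_trans[OF norm_ge_zero C])
    moreover have "norm (\<phi> x) \<le> C / (1 + \<bar>x\<bar>) ^ n" for x
      using C[of "complex_of_real x"] f(2)[of x] by simp
    ultimately show ?thesis
      by auto
  qed
  have "continuous_on S (\<lambda>x. f (complex_of_real x))" for S
    by (intro continuous_on_compose2[OF holomorphic_on_imp_continuous_on[OF f(1)]] continuous_intros) auto
  then show cont: "continuous_on S \<phi>" for S
    by (simp add: f(2))
  show "\<exists>M. \<forall>x. norm (\<phi> x) \<le> M"
    using decay[of 0] by auto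
  \<comment> \<open>Of the k + 2 powers, k absorb the moment and two leave an integrable
    majorant.\<close>
  obtain C where C: "C \<ge> 0" "\<And>x. norm (\<phi> x) \<le> C / (1 + \<bar>x\<bar>) ^ (k + 2)"
    using decay by blast
  show "integrable lborel (\<lambda>x. complex_of_real x ^ k * \<phi> x)"
  proof (rule integrable_inverse_square)
    fix x :: real
    have "norm (complex_of_real x ^ k * \<phi> x) \<le> (1 + \<bar>x\<bar>) ^ k * (C / (1 + \<bar>x\<bar>) ^ (k + 2))"
      unfolding norm_mult norm_power using C by (intro mult_mono power_mono) auto
    also have "\<dots> = C / (1 + \<bar>x\<bar>)\<^sup>2"
      by (simp add: power_add add_nonneg_eq_0_iff power2_eq_square)
    also have "\<dots> \<le> C / (1 + x\<^sup>2)"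
      using C by (intro divide_left_mono)
        (auto simp: power2_sum intro!: mult_pos_pos add_pos_nonneg)
    finally show "norm (complex_of_real x ^ k * \<phi> x) \<le> C / (1 + x\<^sup>2)" .
  qed (intro continuous_intros cont)
qed

lemma Z_space_integrable: "\<phi> \<in> Z_space \<Longrightarrow> integrable lborel \<phi>"
  using Z_space_integrable_power[of \<phi> 0] by simp

text \<open>Each derivative brings a factor i x under the integral, so integrable moments of every
  order supply the whole tower of derivatives.\<close>

lemma smooth_fourier_adj:
  assumes u: "\<And>k. integrable lborel (\<lambda>x. complex_of_real x ^ k * u x)"
  shows "smooth (fourier_adj u)"
proof -
  define c where "c = complex_of_real (1 / sqrt (2 * pi))"
  define G where "G k t = c * (\<i> ^ k * (LINT x|lborel. (complex_of_real x ^ k * u x) * exp (\<i> * complex_of_real (t * x))))" for k t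
  show ?thesis
  proof (rule smoothI[of G])
    show "G 0 = fourier_adj u"
      by (simp add: G_def[abs_def] c_def fourier_adj_def[abs_def])
    fix k t
    have "integrable lborel (\<lambda>x. complex_of_real x * (complex_of_real x ^ k * u x))"
      using u[of "Suc k"] by (simp add: mult.assoc)
    note has_vector_derivative_mult_right[OF has_vector_derivative_mult_right[OF
        fourier_integral_has_vector_derivative[OF u this]]]
    from this[of c "\<i> ^ k" t] show "(G k has_vector_derivative G (Suc k) t) (at t)"
      by (simp add: G_def[abs_def] mult.assoc mult.left_commute)
  qed
qed

text \<open>The exponent r of the growth bound becomes the radius of the support: shifting the line
  upwards gives vanishing for t > r. Decay of order 2 suffices for the shift, while smoothness uses
  decay of every order.\<close>

lemma fourier_adj_Z:
  assumes \<phi>: "\<phi> \<in> Z_space"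
  shows "fourier_adj \<phi> \<in> test_space"
proof -
  obtain f r where f: "f holomorphic_on UNIV" "\<And>x. f (complex_of_real x) = \<phi> x"
    and bound: "\<And>n::nat. \<exists>C. \<forall>z. norm (f z) \<le> C / (1 + norm z) ^ n * exp (r * \<bar>Im z\<bar>)"
    using \<phi> unfolding Z_space_def by blast
  obtain C where C: "\<And>z. norm (f z) \<le> C / (1 + norm z) ^ 2 * exp (r * \<bar>Im z\<bar>)"
    using bound by blast
  have pos: "fourier_adj \<phi> t = 0" if "t > r" for t
    using fourier_integral_eq_0[OF f(1) C that] by (simp add: fourier_adj_def f(2))
  \<comment> \<open>The case t < -r is the previous one for z \<mapsto> f(-z), which satisfies the
    same bound.\<close>
  have "(LINT x|lborel. f (- complex_of_real x) * exp (\<i> * complex_of_real (t * x))) = 0" if "t > r" for t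
  proof (rule fourier_integral_eq_0)
    show "norm (f (- z)) \<le> C / (1 + norm z) ^ 2 * exp (r * \<bar>Im z\<bar>)" for z
      using C[of "- z"] by simp
    show "(\<lambda>z. f (- z)) holomorphic_on UNIV"
      using holomorphic_on_compose_gen[of uminus UNIV f UNIV] f(1) by (simp add: o_def holomorphic_on_minus)
  qed (rule that)
  then have "fourier_adj (\<lambda>x. \<phi> (- x)) t = 0" if "t > r" for t
    using that by (simp add: fourier_adj_def f(2)[symmetric])
  then have neg: "fourier_adj \<phi> t = 0" if "- t > r" for t
    using that fourier_adj_reflect[of \<phi> "- t"] by simp
  have "fourier_adj \<phi> \<in> test_space_on {-r..r}"
  proof (rule test_space_onI)
    show "smooth (fourier_adj \<phi>)"
      by (intro smooth_fourier_adj Z_space_integrable_power \<phi>)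
    show "{t. fourier_adj \<phi> t \<noteq> 0} \<subseteq> {-r..r}"
      using pos neg by (force simp: not_less[symmetric])
  qed simp
  then show ?thesis
    using test_space_on_subset by blast
qed

lemma test_space_props:
  assumes "g \<in> test_space"
  shows test_space_integrable: "integrable lborel g"
    and test_space_bounded: "\<exists>M. \<forall>x. norm (g x) \<le> M"
    and test_space_continuous_on: "continuous_on S g"
proof -
  obtain R where "R > 0" and R: "g \<in> test_space_on {-R..R}"
    using assms by (rule test_spaceE)
  show cont: "continuous_on S g" for S
    using smooth_continuous_on[of g S 0] assms test_space_smooth by simp
  have supp: "indicat_real {-R..R} x *\<^sub>R g x = g x" for x
    using test_space_on_support[OF R] by (auto simp: indicator_def)
  show "integrable lborel g"
    using borel_integrable_atLeastAtMost'[OF cont, of "-R" R] by (simp add: set_integrable_def supp)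
  have "bounded (g ` {-R..R})"
    by (intro compact_imp_bounded compact_continuous_image cont) simp
  then obtain M where M: "M > 0" "\<And>x. x \<in> {-R..R} \<Longrightarrow> norm (g x) \<le> M"
    by (auto simp: bounded_pos)
  have "norm (g x) \<le> M" for x
    using M test_space_on_support[OF R] by (cases "g x = 0") auto
  then show "\<exists>M. \<forall>x. norm (g x) \<le> M"
    by blast
qed

subsection \<open>Transport of antidual spaces\<close>

text \<open>In the topology of pointwise convergence the transpose is continuous because evaluating
  its value at f is \<open>c\<close> times evaluating u at \<open>A f\<close>. Continuity of
  \<open>A\<close> keeps the transposed functional continuous.\<close>

lemma antidual_compose:
  assumes A: "continuous_map T S A"
    and T: "\<And>f g a b. f \<in> topspace T \<Longrightarrow> g \<in> topspace T \<Longrightarrow> (\<lambda>x. a * f x + b * g x) \<in> topspace T"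
    and lin: "\<And>f g a b. f \<in> topspace T \<Longrightarrow> g \<in> topspace T \<Longrightarrow>
      A (\<lambda>x. a * f x + b * g x) = (\<lambda>x. a * A f x + b * A g x)"
  shows "u \<in> antidual S \<Longrightarrow> (\<lambda>f\<in>topspace T. c * u (A f)) \<in> antidual T"
    and "continuous_map (antidual_topology S) (antidual_topology T) (\<lambda>u. \<lambda>f\<in>topspace T. c * u (A f))"
proof -
  have AS: "A f \<in> topspace S" if "f \<in> topspace T" for f
    using A that by (auto simp: continuous_map_def)
  have mult: "continuous_map euclidean euclidean (\<lambda>z::complex. c * z)"
    unfolding continuous_map_iff_continuous2 by (intro continuous_intros)
  show *: "(\<lambda>f\<in>topspace T. c * u (A f)) \<in> antidual T" if u: "u \<in> antidual S" for u
    unfolding antidual_def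
  proof (intro CollectI conjI ballI allI)
    fix f g assume fg: "f \<in> topspace T" "g \<in> topspace T"
    have "u (A (\<lambda>x. f x + g x)) = u (A f) + u (A g)"
      using u lin[of f g 1 1] fg AS by (simp add: antidual_def)
    then show "(\<lambda>f\<in>topspace T. c * u (A f)) (\<lambda>x. f x + g x) =
        (\<lambda>f\<in>topspace T. c * u (A f)) f + (\<lambda>f\<in>topspace T. c * u (A f)) g"
      using fg T[of f g 1 1] by (simp add: distrib_left)
  next
    fix f a assume f: "f \<in> topspace T"
    have "u (A (\<lambda>x. a * f x)) = cnj a * u (A f)"
      using u lin[of f f a 0] f AS by (simp add: antidual_def)
    then show "(\<lambda>f\<in>topspace T. c * u (A f)) (\<lambda>x. a * f x) = cnj a * (\<lambda>f\<in>topspace T. c * u (A f)) f"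
      using f T[of f f a 0] by simp
  next
    have "continuous_map S euclidean u"
      using u by (simp add: antidual_def)
    then have "continuous_map T euclidean ((\<lambda>z. c * z) \<circ> (u \<circ> A))"
      by (intro continuous_map_compose[OF _ mult] continuous_map_compose[OF A])
    then show "continuous_map T euclidean (\<lambda>f\<in>topspace T. c * u (A f))"
      by (rule continuous_map_eq) simp
  qed simp
  have "continuous_map (antidual_topology S) (product_topology (\<lambda>_. euclidean) (topspace T))
      (\<lambda>u. \<lambda>f\<in>topspace T. c * u (A f))"
    unfolding continuous_map_componentwise
  proof (intro conjI ballI)
    fix f assume f: "f \<in> topspace T"
    have "continuous_map (antidual_topology S) euclidean (\<lambda>u. u (A f))"
      unfolding antidual_topology_def
      by (intro continuous_map_from_subtopology continuous_map_product_projection AS f)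
    from continuous_map_compose[OF this mult]
    show "continuous_map (antidual_topology S) euclidean (\<lambda>u. (\<lambda>f\<in>topspace T. c * u (A f)) f)"
      using f by (simp add: o_def)
  qed auto
  then show "continuous_map (antidual_topology S) (antidual_topology T) (\<lambda>u. \<lambda>f\<in>topspace T. c * u (A f))"
    unfolding antidual_topology_def[of T]
    by (intro continuous_map_into_subtopology)
       (auto simp: topspace_antidual_topology intro: *)
qed

text \<open>Transposition reverses composition, so the transpose of \<open>B\<close>, divided by
  \<open>c\<close>, inverts \<open>D\<close>. The linear structure of the source of
  \<open>B\<close>, and the linearity of \<open>B\<close>, are transported through \<open>A\<close>.
  The conclusion has the form of one block of the final theorem.\<close>

lemma antidual_homeomorphism:
  assumes A: "continuous_map T S A" and B: "continuous_map S T B"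
    and BA: "\<And>f. f \<in> topspace T \<Longrightarrow> B (A f) = f" and AB: "\<And>f. f \<in> topspace S \<Longrightarrow> A (B f) = f"
    and T: "\<And>f g a b. f \<in> topspace T \<Longrightarrow> g \<in> topspace T \<Longrightarrow> (\<lambda>x. a * f x + b * g x) \<in> topspace T"
    and lin: "\<And>f g a b. f \<in> topspace T \<Longrightarrow> g \<in> topspace T \<Longrightarrow>
      A (\<lambda>x. a * f x + b * g x) = (\<lambda>x. a * A f x + b * A g x)"
    and c: "c \<noteq> 0"
    and D: "D = (\<lambda>u. \<lambda>f\<in>topspace T. c * u (A f))"
  shows "bij_betw D (antidual S) (antidual T) \<and>
    continuous_map (antidual_topology S) (antidual_topology T) D \<and>
    continuous_map (antidual_topology T) (antidual_topology S) (inv_into (antidual S) D)"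
proof -
  have AS: "A f \<in> topspace S" if "f \<in> topspace T" for f
    using A that by (auto simp: continuous_map_def)
  have BT: "B f \<in> topspace T" if "f \<in> topspace S" for f
    using B that by (auto simp: continuous_map_def)
  have S: "(\<lambda>x. a * f x + b * g x) \<in> topspace S"
    and linB: "B (\<lambda>x. a * f x + b * g x) = (\<lambda>x. a * B f x + b * B g x)"
    if "f \<in> topspace S" "g \<in> topspace S" for f g a b
  proof -
    have *: "A (\<lambda>x. a * B f x + b * B g x) = (\<lambda>x. a * f x + b * g x)"
      using that by (simp add: lin BT AB)
    show "(\<lambda>x. a * f x + b * g x) \<in> topspace S"
      using AS[OF T[OF BT[OF that(1)] BT[OF that(2)]], of a b] * by simp
    show "B (\<lambda>x. a * f x + b * g x) = (\<lambda>x. a * B f x + b * B g x)"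
      using BA[OF T[OF BT[OF that(1)] BT[OF that(2)]], of a b] * by simp
  qed
  define E where "E v = (\<lambda>f\<in>topspace S. 1 / c * v (B f))" for v
  have ED: "E (D u) = u" if "u \<in> antidual S" for u
  proof (rule extensionalityI)
    show "u \<in> extensional (topspace S)"
      using that by (simp add: antidual_def)
  qed (use c in \<open>auto simp: E_def D BT AB\<close>)
  have DE: "D (E v) = v" if "v \<in> antidual T" for v
  proof (rule extensionalityI)
    show "v \<in> extensional (topspace T)"
      using that by (simp add: antidual_def)
  qed (use c in \<open>auto simp: E_def D AS BA\<close>)
  have D_in: "D u \<in> antidual T" if "u \<in> antidual S" for u
    unfolding D by (rule antidual_compose(1)[OF A T lin that])
  have E_in: "E v \<in> antidual S" if "v \<in> antidual T" for v
    unfolding E_def by (rule antidual_compose(1)[OF B S linB that])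
  have bij: "bij_betw D (antidual S) (antidual T)"
    by (rule bij_betw_byWitness[of _ E]) (use ED DE D_in E_in in auto)
  have "continuous_map (antidual_topology T) (antidual_topology S) E"
    unfolding E_def[abs_def] by (rule antidual_compose(2)[OF B S linB])
  \<comment> \<open>\<open>inv_into\<close> is determined only on the image of \<open>D\<close>;
    agreement there with \<open>E\<close> is enough, since \<open>antidual T\<close> is the carrier
    of the dual topology.\<close>
  moreover have "E v = inv_into (antidual S) D v" if "v \<in> antidual T" for v
    using inv_into_f_f[OF bij_betw_imp_inj_on[OF bij] E_in[OF that]] by (simp add: DE that)
  ultimately have "continuous_map (antidual_topology T) (antidual_topology S) (inv_into (antidual S) D)"
    by (auto intro: continuous_map_eq simp: topspace_antidual_topology)
  moreover have "continuous_map (antidual_topology S) (antidual_topology T) D"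
    unfolding D by (rule antidual_compose(2)[OF A T lin])
  ultimately show ?thesis
    using bij by blast
qed

section \<open>The Fourier transform as a bijection between test functions and Z\<close>

text \<open>The two transforms differ by a reflection, and the two reflections that arise cancel.
  This reduces the other order of composition to \<open>fourier_adj_fourier\<close> under the same
  hypotheses.\<close>

lemma fourier_fourier_adj:
  assumes "continuous_on UNIV f" "\<And>x. norm (f x) \<le> M" "integrable lborel f" "integrable lborel (fourier f)"
  shows "fourier (fourier_adj f) x = f x"
proof -
  have "fourier (fourier_adj f) x = fourier_adj (\<lambda>y. fourier f (- y)) (- x)"
    by (simp add: fourier_eq_fourier_adj)
  also have "\<dots> = f x"
    using fourier_adj_fourier[OF assms] by (simp add: fourier_adj_reflect)
  finally show ?thesis .
qed

lemma fourier_conv_reflect: "fourier u = fourier_adj (\<lambda>x. u (- x))"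
  by (rule ext) (simp add: fourier_eq_fourier_adj fourier_adj_reflect)

lemma fourier_test: "g \<in> test_space \<Longrightarrow> fourier g \<in> Z_space"
  unfolding fourier_conv_reflect by (intro fourier_adj_test reflect_test_space)

lemma fourier_Z: "\<phi> \<in> Z_space \<Longrightarrow> fourier \<phi> \<in> test_space"
  using reflect_test_space[OF fourier_adj_Z] by (simp add: fourier_eq_fourier_adj[abs_def])

text \<open>Integrability of the transform, required for inversion, comes from Paley--Wiener: the
  transform lies in \<open>Z_space\<close>.\<close>

lemma fourier_inverse_test:
  assumes "g \<in> test_space"
  shows "fourier (fourier_adj g) = g" "fourier_adj (fourier g) = g"
proof -
  obtain M where "\<And>x. norm (g x) \<le> M"
    using test_space_bounded[OF assms] by blast
  then show "fourier (fourier_adj g) = g" "fourier_adj (fourier g) = g"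
    using fourier_fourier_adj fourier_adj_fourier test_space_continuous_on[OF assms]
      test_space_integrable[OF assms] Z_space_integrable[OF fourier_test[OF assms]] by blast+
qed

lemma fourier_inverse_Z:
  assumes "\<phi> \<in> Z_space"
  shows "fourier (fourier_adj \<phi>) = \<phi>" "fourier_adj (fourier \<phi>) = \<phi>"
proof -
  obtain M where "\<And>x. norm (\<phi> x) \<le> M"
    using Z_space_bounded[OF assms] by blast
  then show "fourier (fourier_adj \<phi>) = \<phi>" "fourier_adj (fourier \<phi>) = \<phi>"
    using fourier_fourier_adj fourier_adj_fourier Z_space_continuous_on[OF assms]
      Z_space_integrable[OF assms] test_space_integrable[OF fourier_Z[OF assms]] by blast+
qed

section \<open>Carrier, linear structure and continuous maps of Z\<close>

text \<open>A pullback topology keeps only the points that are mapped into the target carrier; the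
  converse half of Paley--Wiener ensures that none are lost.\<close>

lemma topspace_Z_topology: "topspace Z_topology = Z_space"
  using fourier_adj_Z by (auto simp: Z_topology_def topspace_pullback_topology topspace_test_topology)

lemma topspace_Zplus_topology: "topspace Zplus_topology = Zplus_space"
  by (auto simp: Zplus_topology_def topspace_pullback_topology topspace_Z_topology Zplus_space_def)

lemma fourier_adj_lincomb:
  assumes "integrable lborel f" "integrable lborel g"
  shows "fourier_adj (\<lambda>x. a * f x + b * g x) = (\<lambda>x. a * fourier_adj f x + b * fourier_adj g x)"
proof
  fix x
  have int: "integrable lborel (\<lambda>\<xi>. u \<xi> * exp (\<i> * complex_of_real (x * \<xi>)))"
    if u: "integrable lborel u" for u :: "real \<Rightarrow> complex"
  proof (rule Bochner_Integration.integrable_bound[OF u])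
    have [measurable]: "u \<in> borel_measurable borel"
      using borel_measurable_integrable[OF u] by simp
    show "(\<lambda>\<xi>. u \<xi> * exp (\<i> * complex_of_real (x * \<xi>))) \<in> borel_measurable lborel"
      by measurable
  qed (simp add: norm_mult)
  have "(LINT \<xi>|lborel. (a * f \<xi> + b * g \<xi>) * exp (\<i> * complex_of_real (x * \<xi>))) =
      (LINT \<xi>|lborel. a * (f \<xi> * exp (\<i> * complex_of_real (x * \<xi>))) + b * (g \<xi> * exp (\<i> * complex_of_real (x * \<xi>))))"
    by (simp add: distrib_right mult.assoc)
  also have "\<dots> = a * (LINT \<xi>|lborel. f \<xi> * exp (\<i> * complex_of_real (x * \<xi>))) +
      b * (LINT \<xi>|lborel. g \<xi> * exp (\<i> * complex_of_real (x * \<xi>)))"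
    by (subst Bochner_Integration.integral_add[OF integrable_mult_right[OF int[OF assms(1)]]
          integrable_mult_right[OF int[OF assms(2)]]]) simp
  finally show "fourier_adj (\<lambda>x. a * f x + b * g x) x = a * fourier_adj f x + b * fourier_adj g x"
    unfolding fourier_adj_def by (simp only: distrib_left mult.left_commute)
qed

lemma fourier_lincomb:
  assumes "integrable lborel f" "integrable lborel g"
  shows "fourier (\<lambda>x. a * f x + b * g x) = (\<lambda>x. a * fourier f x + b * fourier g x)"
  by (simp add: fourier_eq_fourier_adj[abs_def] fourier_adj_lincomb assms)

text \<open>Passing to the test functions and back avoids combining growth bounds of different
  exponential types.\<close>

lemma Z_space_lincomb:
  assumes "f \<in> Z_space" "g \<in> Z_space"
  shows "(\<lambda>x. a * f x + b * g x) \<in> Z_space"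
proof -
  have "(\<lambda>x. a * f x + b * g x) = fourier_adj (\<lambda>x. a * fourier f x + b * fourier g x)"
    using assms by (simp add: fourier_adj_lincomb test_space_integrable fourier_Z fourier_inverse_Z)
  then show ?thesis
    using assms by (simp add: fourier_adj_test test_space_lincomb fourier_Z)
qed

lemma reflect_Z_space:
  assumes "\<phi> \<in> Z_space"
  shows "(\<lambda>x. \<phi> (- x)) \<in> Z_space"
proof -
  have "(\<lambda>x. \<phi> (- x)) = fourier_adj (\<lambda>x. fourier \<phi> (- x))"
    by (simp add: fourier_adj_reflect[abs_def] fourier_inverse_Z assms)
  then show ?thesis
    using assms by (simp add: fourier_adj_test reflect_test_space fourier_Z)
qed

text \<open>\<open>fourier_adj\<close> is continuous on Z by the definition of the pullback, and
  \<open>fourier\<close> is its composition with the reflection.\<close>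

lemma continuous_map_fourier: "continuous_map Z_topology test_topology fourier"
proof -
  have "continuous_map Z_topology test_topology ((\<lambda>f x. f (- x)) \<circ> fourier_adj)"
    unfolding Z_topology_def by (intro continuous_map_pullback continuous_map_reflect)
  then show ?thesis
    by (simp add: o_def fourier_eq_fourier_adj[abs_def])
qed

lemma continuous_map_fourier_adj: "continuous_map test_topology Z_topology fourier_adj"
  unfolding Z_topology_def
proof (rule continuous_map_pullback')
  have "(\<lambda>x. g (- x)) = fourier_adj (fourier_adj g)" if "g \<in> test_space" for g
  proof
    fix x
    show "g (- x) = fourier_adj (fourier_adj g) x"
      using fourier_eq_fourier_adj[of "fourier_adj g" "- x"] fourier_inverse_test(1)[OF that] by simp
  qed
  then show "continuous_map test_topology test_topology (fourier_adj \<circ> fourier_adj)"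
    by (intro continuous_map_eq[OF continuous_map_reflect]) (simp add: topspace_test_topology)
qed (auto simp: topspace_test_topology fourier_adj_test)

lemma continuous_map_reflect_Z: "continuous_map Z_topology Z_topology (\<lambda>f x. f (- x))"
proof -
  have "continuous_map Z_topology test_topology ((\<lambda>f x. f (- x)) \<circ> fourier_adj)"
    unfolding Z_topology_def by (intro continuous_map_pullback continuous_map_reflect)
  also have "(\<lambda>f x. f (- x)) \<circ> fourier_adj = fourier_adj \<circ> (\<lambda>f x. f (- x))"
    by (simp add: fun_eq_iff fourier_adj_reflect)
  finally have "continuous_map Z_topology test_topology (fourier_adj \<circ> (\<lambda>f x. f (- x)))" .
  moreover have "topspace Z_topology \<subseteq> (\<lambda>f x. f (- x)) -` Z_space"
    by (auto simp: topspace_Z_topology reflect_Z_space)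
  ultimately have "continuous_map Z_topology (pullback_topology Z_space fourier_adj test_topology) (\<lambda>f x. f (- x))"
    by (rule continuous_map_pullback')
  then show ?thesis
    by (simp add: Z_topology_def)
qed

section \<open>The exponential substitution\<close>

definition exp_comp :: "(real \<Rightarrow> complex) \<Rightarrow> real \<Rightarrow> complex" where
  "exp_comp F x = F (exp x)"

definition ln_comp :: "(real \<Rightarrow> complex) \<Rightarrow> real \<Rightarrow> complex" where
  "ln_comp \<Omega> t = (if t > 0 then \<Omega> (ln t) else 0)"

lemma exp_comp_ln_comp: "exp_comp (ln_comp \<Omega>) = \<Omega>"
  by (simp add: exp_comp_def[abs_def] ln_comp_def)

lemma ln_comp_exp_comp: "F \<in> Zplus_space \<Longrightarrow> ln_comp (exp_comp F) = F"
  by (auto simp: exp_comp_def[abs_def] ln_comp_def fun_eq_iff Zplus_space_def)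

lemma ln_comp_Z: "\<Omega> \<in> Z_space \<Longrightarrow> ln_comp \<Omega> \<in> Zplus_space"
  by (simp add: ln_comp_def Zplus_space_def)

lemma Zplus_topology_exp_comp: "Zplus_topology = pullback_topology Zplus_space exp_comp Z_topology"
  by (simp add: Zplus_topology_def exp_comp_def[abs_def])

lemma continuous_map_exp_comp: "continuous_map Zplus_topology Z_topology exp_comp"
  unfolding Zplus_topology_exp_comp
  using continuous_map_pullback[OF continuous_map_id, of Zplus_space exp_comp Z_topology] by simp

lemma continuous_map_ln_comp: "continuous_map Z_topology Zplus_topology ln_comp"
  unfolding Zplus_topology_exp_comp
proof (rule continuous_map_pullback')
  have "exp_comp \<circ> ln_comp = id"
    by (simp add: fun_eq_iff exp_comp_ln_comp)
  then show "continuous_map Z_topology Z_topology (exp_comp \<circ> ln_comp)"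
    by simp
qed (auto simp: topspace_Z_topology ln_comp_Z)

lemma Zplus_space_lincomb:
  assumes "F \<in> Zplus_space" "G \<in> Zplus_space"
  shows "(\<lambda>t. a * F t + b * G t) \<in> Zplus_space"
  using assms Z_space_lincomb by (auto simp: Zplus_space_def)

section \<open>The Gamma factor and its reciprocal\<close>

text \<open>The poles of \<open>Gamma (1 + \<i> * z)\<close> are z = i, 2i, 3i, ..., so the
  half-plane Im z < 1 avoids them and contains the real line.\<close>

lemma one_plus_i_times_not_nonpos_Int:
  assumes "Im z < 1"
  shows "1 + \<i> * z \<notin> \<int>\<^sub>\<le>\<^sub>0"
proof
  assume "1 + \<i> * z \<in> \<int>\<^sub>\<le>\<^sub>0"
  then obtain n where n: "1 + \<i> * z = of_int n" "n \<le> 0"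
    by (elim nonpos_Ints_cases)
  from arg_cong[OF n(1), of Re] n(2) assms show False
    by simp
qed

text \<open>The reciprocal is entire in the form \<open>rGamma\<close>, so no domain has to be
  chosen.\<close>

lemma smooth_inverse_Gamma: "smooth (\<lambda>x. inverse (Gamma (1 + \<i> * complex_of_real x)))"
proof -
  have "smooth (\<lambda>x. rGamma (1 + \<i> * complex_of_real x))"
    by (rule smooth_restrict[of "\<lambda>z. rGamma (1 + \<i> * z)" UNIV]) (auto intro!: holomorphic_intros)
  then show ?thesis
    by (simp add: rGamma_inverse_Gamma)
qed

lemma smooth_Gamma: "smooth (\<lambda>x. Gamma (1 + \<i> * complex_of_real x))"
proof (rule smooth_restrict[of "\<lambda>z. Gamma (1 + \<i> * z)" "{z. Im z < 1}"])
  show "(\<lambda>z. Gamma (1 + \<i> * z)) holomorphic_on {z. Im z < 1}"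
    by (auto intro!: holomorphic_intros dest: one_plus_i_times_not_nonpos_Int)
qed (auto simp: open_halfspace_Im_lt)

theorem proposition2p5:
  shows
    "(bij_betw theta_of_h (antidual Zplus_topology) (antidual Z_topology) \<and>
      continuous_map (antidual_topology Zplus_topology) (antidual_topology Z_topology) theta_of_h \<and>
      continuous_map (antidual_topology Z_topology) (antidual_topology Zplus_topology)
        (inv_into (antidual Zplus_topology) theta_of_h)) \<and>
     (bij_betw a_of_theta (antidual Z_topology) (antidual test_topology) \<and>
      continuous_map (antidual_topology Z_topology) (antidual_topology test_topology) a_of_theta \<and>
      continuous_map (antidual_topology test_topology) (antidual_topology Z_topology)
        (inv_into (antidual Z_topology) a_of_theta)) \<and>
     (bij_betw b_of_a (antidual test_topology) (antidual test_topology) \<and>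
      continuous_map (antidual_topology test_topology) (antidual_topology test_topology) b_of_a \<and>
      continuous_map (antidual_topology test_topology) (antidual_topology test_topology)
        (inv_into (antidual test_topology) b_of_a)) \<and>
     (bij_betw s_of_b (antidual test_topology) (antidual Z_topology) \<and>
      continuous_map (antidual_topology test_topology) (antidual_topology Z_topology) s_of_b \<and>
      continuous_map (antidual_topology Z_topology) (antidual_topology test_topology)
        (inv_into (antidual test_topology) s_of_b)) \<and>
     (bij_betw hnat_of_s (antidual Z_topology) (antidual Zplus_topology) \<and>
      continuous_map (antidual_topology Z_topology) (antidual_topology Zplus_topology) hnat_of_s \<and>
      continuous_map (antidual_topology Zplus_topology) (antidual_topology Z_topology)
        (inv_into (antidual Z_topology) hnat_of_s))"
proof (intro conjI[of "_ \<and> _ \<and> _"])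
  note topspace = topspace_Z_topology topspace_Zplus_topology topspace_test_topology
  show "bij_betw theta_of_h (antidual Zplus_topology) (antidual Z_topology) \<and>
      continuous_map (antidual_topology Zplus_topology) (antidual_topology Z_topology) theta_of_h \<and>
      continuous_map (antidual_topology Z_topology) (antidual_topology Zplus_topology)
        (inv_into (antidual Zplus_topology) theta_of_h)"
  \<comment> \<open>The operator on test functions runs against the direction of the map on
    functionals, here from \<open>Z_space\<close> to \<open>Zplus_space\<close>.\<close>
  proof (rule antidual_homeomorphism[OF continuous_map_ln_comp continuous_map_exp_comp])
    show "theta_of_h = (\<lambda>h. \<lambda>\<Omega>\<in>topspace Z_topology. 1 * h (ln_comp \<Omega>))"
      by (simp add: theta_of_h_def[abs_def] topspace ln_comp_def[abs_def])
  qed (auto simp: topspace exp_comp_ln_comp ln_comp_exp_comp Z_space_lincomb fun_eq_iff ln_comp_def)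
  show "bij_betw a_of_theta (antidual Z_topology) (antidual test_topology) \<and>
      continuous_map (antidual_topology Z_topology) (antidual_topology test_topology) a_of_theta \<and>
      continuous_map (antidual_topology test_topology) (antidual_topology Z_topology)
        (inv_into (antidual Z_topology) a_of_theta)"
  proof (rule antidual_homeomorphism[OF continuous_map_fourier_adj continuous_map_fourier])
    show "a_of_theta = (\<lambda>\<theta>. \<lambda>g\<in>topspace test_topology. 1 * \<theta> (fourier_adj g))"
      by (simp add: a_of_theta_def[abs_def] topspace)
  qed (simp_all add: topspace fourier_inverse_test fourier_inverse_Z test_space_lincomb
      fourier_adj_lincomb test_space_integrable)
  show "bij_betw b_of_a (antidual test_topology) (antidual test_topology) \<and>
      continuous_map (antidual_topology test_topology) (antidual_topology test_topology) b_of_a \<and>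
      continuous_map (antidual_topology test_topology) (antidual_topology test_topology)
        (inv_into (antidual test_topology) b_of_a)"
  proof (rule antidual_homeomorphism[OF continuous_map_mult[OF smooth_inverse_Gamma] continuous_map_mult[OF smooth_Gamma]])
    show "b_of_a = (\<lambda>a. \<lambda>G\<in>topspace test_topology. complex_of_real (1 / sqrt (2 * pi)) *
        a (\<lambda>\<xi>. inverse (Gamma (1 + \<i> * complex_of_real \<xi>)) * G \<xi>))"
      by (simp add: b_of_a_def[abs_def] topspace)
    \<comment> \<open>\<open>Gamma\<close> takes the value 0 exactly at its poles, by convention, so
      avoiding the poles makes the two multiplications mutually inverse.\<close>
    have "Gamma (1 + \<i> * complex_of_real x) \<noteq> 0" for x
      by (simp add: Gamma_eq_zero_iff one_plus_i_times_not_nonpos_Int)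
    then show "(\<lambda>x. Gamma (1 + \<i> * complex_of_real x) * (inverse (Gamma (1 + \<i> * complex_of_real x)) * f x)) = f"
      "(\<lambda>x. inverse (Gamma (1 + \<i> * complex_of_real x)) * (Gamma (1 + \<i> * complex_of_real x) * f x)) = f"
      for f by (simp_all add: mult.assoc[symmetric])
  qed (simp_all add: topspace test_space_lincomb distrib_left mult.left_commute)
  show "bij_betw s_of_b (antidual test_topology) (antidual Z_topology) \<and>
      continuous_map (antidual_topology test_topology) (antidual_topology Z_topology) s_of_b \<and>
      continuous_map (antidual_topology Z_topology) (antidual_topology test_topology)
        (inv_into (antidual test_topology) s_of_b)"
  proof (rule antidual_homeomorphism[OF continuous_map_fourier continuous_map_fourier_adj])
    show "s_of_b = (\<lambda>b. \<lambda>\<phi>\<in>topspace Z_topology. complex_of_real (sqrt (2 * pi)) * b (fourier \<phi>))"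
      by (simp add: s_of_b_def[abs_def] topspace)
  qed (simp_all add: topspace fourier_inverse_test fourier_inverse_Z Z_space_lincomb
      fourier_lincomb Z_space_integrable)
  show "bij_betw hnat_of_s (antidual Z_topology) (antidual Zplus_topology) \<and>
      continuous_map (antidual_topology Z_topology) (antidual_topology Zplus_topology) hnat_of_s \<and>
      continuous_map (antidual_topology Zplus_topology) (antidual_topology Z_topology)
        (inv_into (antidual Z_topology) hnat_of_s)"
  \<comment> \<open>F(e^(-x)) arises by substituting the exponential and reflecting the result; the
    inverse undoes the reflection before \<open>ln_comp\<close>.\<close>
  proof (rule antidual_homeomorphism[OF continuous_map_compose[OF continuous_map_exp_comp continuous_map_reflect_Z]
        continuous_map_compose[OF continuous_map_reflect_Z continuous_map_ln_comp]])
    show "hnat_of_s = (\<lambda>s. \<lambda>F\<in>topspace Zplus_topology. 1 * s (((\<lambda>f x. f (- x)) \<circ> exp_comp) F))"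
      by (simp add: hnat_of_s_def[abs_def] topspace exp_comp_def)
    show "(ln_comp \<circ> (\<lambda>f x. f (- x))) (((\<lambda>f x. f (- x)) \<circ> exp_comp) F) = F"
      if "F \<in> topspace Zplus_topology" for F
      using that by (simp add: topspace ln_comp_exp_comp)
  qed (simp_all add: topspace exp_comp_ln_comp Zplus_space_lincomb exp_comp_def)
qed

end
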